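(* Let $X$ and $Y$ be independent of $q$. Then $$U_3\left(\frac{f_6}{f_2}\,(qX,\,q/X,\,qY,\,q/Y;\,q^2)_\infty\right) = \left(\frac{f_6}{f_2}\,(qX,\,q/X,\,qY,\,q/Y;\,q^2)_\infty\right)^3 .$$
   Context: All series are power series in $q$ whose coefficients do not depend on $q$; with $X,Y$ (invertible) parameters independent of $q$, they may be read as elements of $\mathbb{Z}[X,X^{-1},Y,Y^{-1}][[q]]$. The $q$-Pochhammer symbol is $(a;q)_\infty := \prod_{k\ge 0}(1-aq^k)$, so that $(a;q^m)_\infty=\prod_{k\ge 0}(1-aq^{mk})$, and $(a_1,a_2,\ldots,a_r;q^m)_\infty := \prod_{j=1}^r (a_j;q^m)_\infty$. For a positive integer $i$, $f_i := (q^i;q^i)_\infty=\prod_{k\ge 1}(1-q^{ik})$. For a positive integer $m$, the unitizing operator of degree $m$ acts on power series in $q$ by $U_m\left(\sum_{n\ge 0} a_n q^n\right) := \sum_{n\ge 0} a_{mn} q^n$, where the coefficients $a_n$ are independent of $q$. *)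

theory Defs
  imports "HOL-Analysis.Infinite_Products" "HOL-Computational_Algebra.Formal_Power_Series"
begin

text \<open>
  Power series in \<open>q\<close> are elements of \<^typ>\<open>'a fps\<close> with \<open>q\<close> = \<^const>\<open>fps_X\<close>. Infinite
  products are taken in the library's metric on \<^typ>\<open>'a fps\<close>, in which convergence means that
  every coefficient is eventually constant.
\<close>

definition qpoch_inf :: "'a::comm_ring_1 fps \<Rightarrow> nat \<Rightarrow> 'a fps"
  where "qpoch_inf a m = (\<Prod>k. 1 - a * fps_X ^ (m * k))"

definition qpoch_inf_list :: "'a::comm_ring_1 fps list \<Rightarrow> nat \<Rightarrow> 'a fps"
  where "qpoch_inf_list as m = (\<Prod>a\<leftarrow>as. qpoch_inf a m)"

definition euler_f :: "nat \<Rightarrow> 'a::comm_ring_1 fps"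
  where "euler_f i = qpoch_inf (fps_X ^ i) i"

text \<open>
  Over a general commutative coefficient ring there is no division on \<^typ>\<open>'a fps\<close>. A series
  with constant coefficient \<open>1\<close> is still a unit; its reciprocal is the library's
  \<open>fps_right_inverse\<close> started at the inverse \<open>1\<close> of that coefficient.
\<close>

definition fps_quot1 :: "'a::comm_ring_1 fps \<Rightarrow> 'a fps \<Rightarrow> 'a fps"
  where "fps_quot1 f g = f * fps_right_inverse g 1"

definition unitize :: "nat \<Rightarrow> 'a fps \<Rightarrow> 'a fps"
  where "unitize m F = Abs_fps (\<lambda>n. fps_nth F (m * n))"

text \<open>
  The defining products converge, and the quotients by \<open>euler_f i\<close> are genuine, in the range of
  parameters that is used (\<open>a\<close> without constant term, \<open>m > 0\<close>, \<open>i > 0\<close>).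
\<close>

lemma qpoch_inf_has_prod:
  fixes a :: "'a::comm_ring_1 fps"
  assumes a0: "fps_nth a 0 = 0" and m: "m > 0"
  shows "(\<lambda>k. 1 - a * fps_X ^ (m * k)) has_prod qpoch_inf a m"
    and "fps_nth (qpoch_inf a m) 0 = 1"
proof -
  define P where "P n = (\<Prod>k\<le>n. 1 - a * fps_X ^ (m * k))" for n
  define L where "L = Abs_fps (\<lambda>j. fps_nth (P j) j)"
  have step: "fps_nth (P (Suc n)) j = fps_nth (P n) j" if "j \<le> n" for n j
  proof -
    have "n < m * Suc n"
      using m by (cases m) simp_all
    then have *: "j < m * Suc n" using that by simp
    have "P (Suc n) = P n - (P n * a) * fps_X ^ (m * Suc n)"
      unfolding P_def prod.atMost_Suc by (simp only: right_diff_distrib mult_1_right mult.assoc)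
    then show ?thesis using * by (simp add: fps_X_power_mult_right_nth del: mult_Suc_right)
  qed
  have const: "fps_nth (P n) j = fps_nth (P j) j" if "j \<le> n" for n j
    using that by (induction n rule: dec_induct) (simp_all add: step)
  have lim: "P \<longlonglongrightarrow> L"
  proof (rule tendsto_fpsI)
    fix j
    show "\<forall>\<^sub>F n in sequentially. fps_nth (P n) j = fps_nth L j"
      using eventually_ge_at_top[of j] by eventually_elim (simp add: L_def, erule const)
  qed
  have L0: "fps_nth L 0 = 1"
    by (simp add: L_def P_def a0)
  then have "L \<noteq> 0" by auto
  with lim have hp: "(\<lambda>k. 1 - a * fps_X ^ (m * k)) has_prod L"
    by (simp add: has_prod_def raw_has_prod_def P_def[abs_def])
  have eq: "qpoch_inf a m = L"
    unfolding qpoch_inf_def prodinf_def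
  proof (rule the_equality, rule hp)
    fix p assume p: "(\<lambda>k. 1 - a * fps_X ^ (m * k)) has_prod p"
    have "1 - a * fps_X ^ (m * k) \<noteq> 0" for k
    proof
      assume "1 - a * fps_X ^ (m * k) = 0"
      then have "fps_nth (1 - a * fps_X ^ (m * k)) 0 = 0" by simp
      then show False by (simp add: a0)
    qed
    with p have "P \<longlonglongrightarrow> p"
      by (simp add: has_prod_def raw_has_prod_def P_def[abs_def])
    then show "p = L" using lim by (rule LIMSEQ_unique)
  qed
  show "(\<lambda>k. 1 - a * fps_X ^ (m * k)) has_prod qpoch_inf a m"
    using hp eq by simp
  show "fps_nth (qpoch_inf a m) 0 = 1"
    using L0 eq by simp
qed

lemma fps_quot1_euler_f:
  fixes g :: "'a::comm_ring_1 fps"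
  assumes "i > 0"
  shows "fps_quot1 g (euler_f i) * euler_f i = g"
proof -
  have "fps_nth (euler_f i :: 'a fps) 0 = 1"
    unfolding euler_f_def using assms by (intro qpoch_inf_has_prod(2)) auto
  then have "euler_f i * fps_right_inverse (euler_f i :: 'a fps) 1 = 1"
    by (intro fps_right_inverse) simp
  then have "fps_right_inverse (euler_f i :: 'a fps) 1 * euler_f i = 1"
    by (simp only: mult.commute)
  then show ?thesis
    unfolding fps_quot1_def mult.assoc by simp
qed

end

theory Submission
  imports Defs
begin

text \<open>
  Put \<open>\<theta>(X) = \<Sum>\<^sub>n (-X)\<^sup>n q\<^bsup>n\<^sup>2\<^esup>\<close>. By the Jacobi triple product the claim concerns
  \<open>F = f\<^sub>6 \<theta>(X) \<theta>(Y) / f\<^sub>2\<^sup>3\<close>. Grouping the triples in \<open>\<theta>(X)\<^sup>3\<close> by their sum gives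
  \<open>\<theta>(X)\<^sup>3 = a \<theta>\<^sub>0(X) + c q \<theta>\<^sub>1(X)\<close>, where \<open>a\<close>, \<open>c\<close> are the cubic theta series (independent of
  \<open>X\<close>) and \<open>\<theta>(X) = \<theta>\<^sub>0(q\<^sup>3) + q \<theta>\<^sub>1(q\<^sup>3)\<close> is the 3-dissection, which has no third component because
  2 is not a square modulo 3. The same grouping applied to Euler's pentagonal series gives
  \<open>f\<^sub>2\<^sup>3 = f\<^sub>6 W\<close> with \<open>W = a(q\<^sup>3) - q\<^sup>2 c(q\<^sup>3)\<close>, so \<open>F W = \<theta>(X) \<theta>(Y)\<close>. Comparing 3-dissections
  and eliminating yields \<open>\<theta>(X)\<^sup>3 \<theta>(Y)\<^sup>3 = U\<^sub>3(F) (a\<^sup>3 - q\<^sup>2 c\<^sup>3)\<close>. Finally \<open>a\<^sup>3 - q\<^sup>2 c\<^sup>3\<close> is the norm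
  of \<open>W\<close> from series in \<open>q\<close> to series in \<open>q\<^sup>3\<close>, and taking norms of Euler products shows that it
  equals \<open>f\<^sub>2\<^sup>9 / f\<^sub>6\<^sup>3\<close>.
\<close>

section \<open>Congruence modulo powers of the variable and Gaussian binomials\<close>

definition eqmod :: "nat \<Rightarrow> 'a::comm_ring_1 fps \<Rightarrow> 'a fps \<Rightarrow> bool"
  where "eqmod M f g \<longleftrightarrow> (\<forall>n<M. fps_nth f n = fps_nth g n)"

lemma eqmod_refl [simp]: "eqmod M f f"
  by (simp add: eqmod_def)

lemma eqmod_sym: "eqmod M f g \<Longrightarrow> eqmod M g f"
  by (simp add: eqmod_def)

lemma eqmod_trans [trans]: "eqmod M f g \<Longrightarrow> eqmod M g h \<Longrightarrow> eqmod M f h"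
  by (simp add: eqmod_def)

lemma eqmod_mult: "eqmod M f f' \<Longrightarrow> eqmod M g g' \<Longrightarrow> eqmod M (f * g) (f' * g')"
  by (auto simp: eqmod_def fps_mult_nth intro!: sum.cong)

lemma eqmod_add: "eqmod M f f' \<Longrightarrow> eqmod M g g' \<Longrightarrow> eqmod M (f + g) (f' + g')"
  by (simp add: eqmod_def)

lemma eqmod_diff: "eqmod M f f' \<Longrightarrow> eqmod M g g' \<Longrightarrow> eqmod M (f - g) (f' - g')"
  by (simp add: eqmod_def)

lemma eqmod_power: "eqmod M f g \<Longrightarrow> eqmod M (f ^ n) (g ^ n)"
  by (induction n) (simp_all add: eqmod_mult)

lemma eqmod_sum: "(\<And>i. i \<in> A \<Longrightarrow> eqmod M (f i) (g i)) \<Longrightarrow> eqmod M (sum f A) (sum g A)"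
  by (auto simp: eqmod_def fps_sum_nth intro!: sum.cong)

text \<open>Identities between infinite products and theta series are proved by truncating both
  sides at an arbitrary precision \<open>M\<close>.\<close>

lemma eqmod_imp_eq: "(\<And>M. eqmod M f g) \<Longrightarrow> f = g"
  unfolding eqmod_def by (metis fps_ext lessI)

text \<open>The coefficient ring may have zero divisors, so cancellation rests on the constant
  coefficient 1, which makes the factor a unit.\<close>

lemma fps_cancel_unit:
  fixes f g h :: "'a::comm_ring_1 fps"
  assumes "fps_nth f 0 = 1" "f * g = f * h"
  shows "g = h"
proof -
  have *: "f * fps_right_inverse f 1 = 1"
    by (rule fps_right_inverse) (simp add: assms)
  have "fps_right_inverse f 1 * (f * g) = fps_right_inverse f 1 * (f * h)"
    by (simp add: assms)
  with * show ?thesis by (simp add: mult.assoc [symmetric] mult.commute [of _ f])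
qed

lemma eqmod_cancel_unit:
  fixes f g h :: "'a::comm_ring_1 fps"
  assumes "fps_nth f 0 = 1" "eqmod M (f * g) (f * h)"
  shows "eqmod M g h"
proof -
  have *: "f * fps_right_inverse f 1 = 1"
    by (rule fps_right_inverse) (simp add: assms)
  have "eqmod M (fps_right_inverse f 1 * (f * g)) (fps_right_inverse f 1 * (f * h))"
    by (intro eqmod_mult assms eqmod_refl)
  with * show ?thesis by (simp add: mult.assoc [symmetric] mult.commute [of _ f])
qed

section \<open>Finite and infinite q-Pochhammer products\<close>

definition qpoch :: "'a::comm_ring_1 fps \<Rightarrow> nat \<Rightarrow> nat \<Rightarrow> 'a fps"
  where "qpoch a m n = (\<Prod>k<n. 1 - a * fps_X ^ (m * k))"

lemma qpoch_0 [simp]: "qpoch a m 0 = 1"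
  by (simp add: qpoch_def)

lemma qpoch_Suc: "qpoch a m (Suc n) = qpoch a m n * (1 - a * fps_X ^ (m * n))"
  by (simp add: qpoch_def)

text \<open>The factor with index k changes only coefficients from \<open>m * k\<close> on, so the
  coefficients below \<open>M\<close> are fixed once \<open>M\<close> factors are taken.\<close>

lemma eqmod_qpoch_inf:
  fixes a :: "'a::comm_ring_1 fps"
  assumes a0: "fps_nth a 0 = 0" and m: "m > 0" and n: "n \<ge> M"
  shows "eqmod M (qpoch a m n) (qpoch_inf a m)"
  unfolding eqmod_def
proof (intro allI impI)
  fix j assume j: "j < M"
  have step: "fps_nth (qpoch a m (Suc n)) j = fps_nth (qpoch a m n) j" if "j < n" for n
  proof -
    have "n \<le> m * n" using m by simp
    with that have *: "j < m * n" by linarith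
    have "qpoch a m (Suc n) = qpoch a m n - (qpoch a m n * a) * fps_X ^ (m * n)"
      by (simp only: qpoch_Suc right_diff_distrib mult_1_right mult.assoc)
    then show ?thesis using * by (simp add: fps_X_power_mult_right_nth)
  qed
  have const: "fps_nth (qpoch a m k) j = fps_nth (qpoch a m n) j" if "n \<le> k" for k
    using that by (induction k rule: dec_induct) (use step j n in auto)
  \<comment> \<open>\<open>has_prod\<close> also covers products with zero factors; nonvanishing
    leaves plain convergence of the partial products.\<close>
  have ne: "1 - a * fps_X ^ (m * k) \<noteq> 0" for k
  proof
    assume "1 - a * fps_X ^ (m * k) = 0"
    then have "fps_nth (1 - a * fps_X ^ (m * k)) 0 = 0" by simp
    then show False by (simp add: a0)
  qed
  have "(\<lambda>n. \<Prod>k\<le>n. 1 - a * fps_X ^ (m * k)) \<longlonglongrightarrow> qpoch_inf a m"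
    using qpoch_inf_has_prod(1)[OF a0 m] ne by (simp add: has_prod_def raw_has_prod_def)
  then have "(\<lambda>n. qpoch a m (Suc n)) \<longlonglongrightarrow> qpoch_inf a m"
    by (simp add: qpoch_def lessThan_Suc_atMost)
  then have "\<forall>\<^sub>F k in sequentially. fps_nth (qpoch a m (Suc k)) j = fps_nth (qpoch_inf a m) j"
    by (simp add: tendsto_fps_iff)
  then obtain K where "\<And>k. k \<ge> K \<Longrightarrow> fps_nth (qpoch a m (Suc k)) j = fps_nth (qpoch_inf a m) j"
    by (auto simp: eventually_at_top_linorder)
  from this[of "max K n"] const[of "Suc (max K n)"]
  show "fps_nth (qpoch a m n) j = fps_nth (qpoch_inf a m) j" by simp
qed

section \<open>Gaussian binomial coefficients\<close>

fun qbinom :: "'a::comm_ring_1 \<Rightarrow> nat \<Rightarrow> nat \<Rightarrow> 'a" where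
  "qbinom Q n 0 = 1"
| "qbinom Q 0 (Suc k) = 0"
| "qbinom Q (Suc n) (Suc k) = qbinom Q n k + Q ^ Suc k * qbinom Q n (Suc k)"

lemma qbinom_eq_0: "n < k \<Longrightarrow> qbinom Q n k = 0"
  by (induction Q n k rule: qbinom.induct) auto

text \<open>The mirrored q-Pascal rule: the defining rule followed by the induction hypothesis gives
  four terms, which the defining rule regroups.\<close>

lemma qbinom_Suc_Suc':
  "k \<le> n \<Longrightarrow> qbinom Q (Suc n) (Suc k) = Q ^ (n - k) * qbinom Q n k + qbinom Q n (Suc k)"
proof (induction n arbitrary: k)
  case (Suc n)
  show ?case
  proof (cases k)
    case 0
    then show ?thesis using Suc.IH[of 0] by (simp add: algebra_simps)
  next
    case (Suc l)
    with Suc.prems have l: "l \<le> n" by simp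
    show ?thesis
    proof (cases "l = n")
      case True
      then show ?thesis using Suc Suc.IH[of n] by (simp add: qbinom_eq_0 algebra_simps)
    next
      case False
      then have e: "Suc l \<le> n" and d: "n - l = Suc (n - Suc l)" using l by auto
      \<comment> \<open>Factoring \<open>Q ^ Suc n\<close> in two ways moves the mixed term from one
        group to the other.\<close>
      have p: "Q ^ Suc l * Q ^ (n - l) = Q ^ Suc n" "Q ^ Suc (Suc l) * Q ^ (n - Suc l) = Q ^ Suc n"
        using e by (simp_all flip: power_add del: power_Suc)
      have "qbinom Q (Suc (Suc n)) (Suc (Suc l))
            = qbinom Q (Suc n) (Suc l) + Q ^ Suc (Suc l) * qbinom Q (Suc n) (Suc (Suc l))"
        by simp
      also have "\<dots> = Q ^ (n - l) * qbinom Q n l + qbinom Q n (Suc l)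
          + Q ^ Suc (Suc l) * (Q ^ (n - Suc l) * qbinom Q n (Suc l) + qbinom Q n (Suc (Suc l)))"
        using Suc.IH[OF l] Suc.IH[OF e] by simp
      also have "\<dots> = Q ^ (n - l) * qbinom Q n l + qbinom Q n (Suc l)
          + (Q ^ Suc (Suc l) * Q ^ (n - Suc l)) * qbinom Q n (Suc l)
          + Q ^ Suc (Suc l) * qbinom Q n (Suc (Suc l))"
        by (simp only: algebra_simps)
      also have "\<dots> = Q ^ (n - l) * (qbinom Q n l + Q ^ Suc l * qbinom Q n (Suc l))
          + (qbinom Q n (Suc l) + Q ^ Suc (Suc l) * qbinom Q n (Suc (Suc l)))"
        unfolding p(2) p(1)[symmetric] by (simp only: algebra_simps)
      also have "\<dots> = Q ^ (Suc n - k) * qbinom Q (Suc n) k + qbinom Q (Suc n) (Suc k)"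
        using Suc by simp
      finally show ?thesis using Suc by simp
    qed
  qed
qed simp

text \<open>Division-free form of the quotient formula for Gaussian binomials. The two terms of the
  defining rule combine through 1 - Q^(k+l) = (1 - Q^k) + Q^k (1 - Q^l).\<close>

lemma qbinom_mult_qpoch:
  fixes r :: nat
  defines "Q \<equiv> (fps_X ^ r :: 'a::comm_ring_1 fps)"
  shows "qbinom Q (k + l) k * qpoch Q r k * qpoch Q r l = qpoch Q r (k + l)"
proof (induction "k + l" arbitrary: k l)
  case (Suc n)
  have pw: "Q * fps_X ^ (r * j) = Q ^ Suc j" for j
    by (simp add: Q_def power_mult)
  show ?case
  proof (cases k)
    case (Suc k')
    show ?thesis
    proof (cases l)
      case 0
      have "qbinom Q k k = 1" for k
        by (induction k) (simp_all add: qbinom_eq_0)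
      then show ?thesis by (simp add: 0)
    next
      case l: (Suc l')
      have 1: "qbinom Q (k' + l) k' * qpoch Q r k' * qpoch Q r l = qpoch Q r (k' + l)"
        by (rule Suc.hyps(1)) (use Suc.hyps(2) Suc in simp)
      have 2: "qbinom Q (k + l') k * qpoch Q r k * qpoch Q r l' = qpoch Q r (k + l')"
        by (rule Suc.hyps(1)) (use Suc.hyps(2) l in simp)
      have kl: "k' + l = k + l'" using Suc l by simp
      have rec: "qbinom Q (k + l) k = qbinom Q (k' + l) k' + Q ^ k * qbinom Q (k + l') k"
        using kl by (simp add: Suc l del: power_Suc)
      have qk: "qpoch Q r k = qpoch Q r k' * (1 - Q ^ k)"
        and ql: "qpoch Q r l = qpoch Q r l' * (1 - Q ^ l)"
        by (simp_all add: Suc l qpoch_Suc pw del: power_Suc)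
      have "qbinom Q (k + l) k * qpoch Q r k * qpoch Q r l
        = qbinom Q (k' + l) k' * (qpoch Q r k' * (1 - Q ^ k)) * qpoch Q r l
          + Q ^ k * qbinom Q (k + l') k * qpoch Q r k * (qpoch Q r l' * (1 - Q ^ l))"
        unfolding rec qk [symmetric] ql [symmetric] by (simp only: ring_distribs mult.assoc)
      also have "\<dots> = (qbinom Q (k' + l) k' * qpoch Q r k' * qpoch Q r l) * (1 - Q ^ k)
          + Q ^ k * (1 - Q ^ l) * (qbinom Q (k + l') k * qpoch Q r k * qpoch Q r l')"
        by (simp only: mult_ac)
      also have "\<dots> = qpoch Q r (k + l') * (1 - Q ^ (k + l))"
        unfolding 1 2 unfolding kl by (simp add: algebra_simps power_add)
      also have "\<dots> = qpoch Q r (k + l)"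
        by (simp add: l qpoch_Suc pw del: power_Suc)
      finally show ?thesis .
    qed
  qed simp
qed simp

text \<open>Modulo q^M every finite product in the quotient formula is \<open>qpoch_inf Q r\<close>,
  and one factor cancels. So the binomial tends to the reciprocal of that product.\<close>

lemma eqmod_qbinom:
  fixes r :: nat
  assumes r: "r > 0" and k: "k \<ge> M" and l: "l \<ge> M"
  defines "Q \<equiv> (fps_X ^ r :: 'a::comm_ring_1 fps)"
  shows "eqmod M (qpoch_inf Q r * qbinom Q (k + l) k) 1"
proof -
  have Q0: "fps_nth Q 0 = 0" using r by (simp add: Q_def)
  have a: "eqmod M (qpoch_inf Q r) (qpoch Q r n)" if "n \<ge> M" for n
    by (rule eqmod_sym, rule eqmod_qpoch_inf[OF Q0 r that])
  have "eqmod M (qbinom Q (k + l) k * qpoch_inf Q r * qpoch_inf Q r)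
        (qbinom Q (k + l) k * qpoch Q r k * qpoch Q r l)"
    by (intro eqmod_mult eqmod_refl a k l)
  also have "\<dots> = qpoch Q r (k + l)"
    unfolding Q_def by (rule qbinom_mult_qpoch)
  also have "eqmod M \<dots> (qpoch_inf Q r)"
    using k by (intro eqmod_sym[OF a]) simp
  finally have "eqmod M (qpoch_inf Q r * (qpoch_inf Q r * qbinom Q (k + l) k)) (qpoch_inf Q r * 1)"
    by (simp add: mult_ac)
  then show ?thesis
    by (rule eqmod_cancel_unit[rotated]) (rule qpoch_inf_has_prod(2)[OF Q0 r])
qed

section \<open>Formal sums and the Jacobi triple product\<close>

text \<open>Integer powers of \<open>x\<close> in a ring without division; \<open>y\<close> plays the role of the inverse of \<open>x\<close>.\<close>

definition zpow :: "'a::comm_ring_1 \<Rightarrow> 'a \<Rightarrow> int \<Rightarrow> 'a"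
  where "zpow x y j = (if 0 \<le> j then x ^ nat j else y ^ nat (- j))"

lemma zpow_0 [simp]: "zpow x y 0 = 1"
  by (simp add: zpow_def)

lemma zpow_add_1:
  assumes "x * y = 1"
  shows "zpow x y (j + 1) = x * zpow x y j"
proof (cases "0 \<le> j")
  case False
  then have "nat (- j) = Suc (nat (- (j + 1)))" by simp
  then have "x * zpow x y j = (x * y) * y ^ nat (- (j + 1))"
    using False by (simp add: zpow_def mult.assoc del: minus_add_distrib)
  then show ?thesis using False assms by (auto simp: zpow_def)
qed (simp add: zpow_def nat_add_distrib)

lemma zpow_diff_1:
  assumes "x * y = 1"
  shows "zpow x y (j - 1) = y * zpow x y j"
proof -
  have "y * zpow x y j = (x * y) * zpow x y (j - 1)"
    using zpow_add_1[OF assms, of "j - 1"] by (simp add: mult_ac)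
  then show ?thesis using assms by simp
qed

lemma zpow_add:
  assumes "x * y = 1"
  shows "zpow x y (i + j) = zpow x y i * zpow x y j"
proof (induction i rule: int_induct[where k = 0])
  case (step1 i)
  then show ?case using zpow_add_1[OF assms, of "i + j"] zpow_add_1[OF assms, of i]
    by (simp add: algebra_simps)
next
  case (step2 i)
  then show ?case using zpow_diff_1[OF assms, of "i + j"] zpow_diff_1[OF assms, of i]
    by (simp add: algebra_simps)
qed simp

text \<open>
  The series \<open>\<Sum>\<^sub>i c\<^sub>i q\<^bsup>e(i)\<^esup>\<close>. It is meaningful only for admissible exponents: terms with
  \<open>e i < 0\<close> are dropped, and a coefficient with infinitely many contributions is \<open>0\<close>.
\<close>

definition msum :: "'i set \<Rightarrow> ('i \<Rightarrow> 'a::comm_ring_1) \<Rightarrow> ('i \<Rightarrow> int) \<Rightarrow> 'a fps"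
  where "msum I c e = Abs_fps (\<lambda>n. \<Sum>i\<in>{i\<in>I. e i = int n}. c i)"

definition admissible :: "'i set \<Rightarrow> ('i \<Rightarrow> int) \<Rightarrow> bool"
  where "admissible I e \<longleftrightarrow> (\<forall>i\<in>I. 0 \<le> e i) \<and> (\<forall>n. finite {i\<in>I. e i \<le> n})"

lemma msum_nth: "fps_nth (msum I c e) n = (\<Sum>i\<in>{i\<in>I. e i = int n}. c i)"
  by (simp add: msum_def)

lemma admissible_finite_eq: "admissible I e \<Longrightarrow> finite {i\<in>I. e i = n}"
  unfolding admissible_def by (auto intro: finite_subset[of _ "{i\<in>I. e i \<le> n}"])

lemma admissible_subset: "admissible I e \<Longrightarrow> J \<subseteq> I \<Longrightarrow> admissible J e"
  unfolding admissible_def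
proof (elim conjE, intro conjI allI)
  fix n assume "J \<subseteq> I" "\<forall>n. finite {i\<in>I. e i \<le> n}"
  then show "finite {i\<in>J. e i \<le> n}"
    by (intro finite_subset[of "{i\<in>J. e i \<le> n}" "{i\<in>I. e i \<le> n}"]) auto
qed auto

lemma admissible_int:
  assumes "\<And>n. n \<in> I \<Longrightarrow> \<bar>n\<bar> \<le> e n"
  shows "admissible I e"
proof -
  have "finite {i\<in>I. e i \<le> n}" for n
    by (rule finite_subset[of _ "{-n..n}"]) (use assms in force)+
  then show ?thesis
    unfolding admissible_def using assms abs_ge_zero order_trans by blast
qed

text \<open>The slack of 1 accommodates \<open>cubic_c\<close>, whose exponent is 0 at (1,
  0).\<close>

lemma admissible_pairs:
  assumes "\<And>i j. 0 \<le> e (i, j)" "\<And>i j. \<bar>i\<bar> \<le> e (i, j) + 1" "\<And>i j. \<bar>j\<bar> \<le> e (i, j) + 1"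
  shows "admissible (UNIV :: (int \<times> int) set) e"
proof -
  have "finite {p \<in> UNIV. e p \<le> n}" for n
  proof (rule finite_subset[of _ "{-n-1..n+1} \<times> {-n-1..n+1}"])
    show "{p \<in> UNIV. e p \<le> n} \<subseteq> {-n-1..n+1} \<times> {-n-1..n+1}"
    proof
      fix p assume "p \<in> {p \<in> UNIV. e p \<le> n}"
      then show "p \<in> {-n-1..n+1} \<times> {-n-1..n+1}"
        using assms(2)[of "fst p" "snd p"] assms(3)[of "snd p" "fst p"]
        by (cases p) auto
    qed
  qed simp
  then show ?thesis
    unfolding admissible_def using assms(1) by auto
qed

lemma admissible_Times:
  assumes "admissible I e" "admissible J f"
  shows "admissible (I \<times> J) (\<lambda>(i, j). e i + f j)"
proof -
  have "finite {p \<in> I \<times> J. (case p of (i, j) \<Rightarrow> e i + f j) \<le> n}" for n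
    by (rule finite_subset[of _ "{i\<in>I. e i \<le> n} \<times> {j\<in>J. f j \<le> n}"])
       (use assms in \<open>force simp: admissible_def\<close>)+
  then show ?thesis
    using assms by (auto simp: admissible_def)
qed

lemma msum_mult:
  assumes "admissible I e" "admissible J f"
  shows "msum I c e * msum J d f = msum (I \<times> J) (\<lambda>(i, j). c i * d j) (\<lambda>(i, j). e i + f j)"
proof (rule fps_ext)
  fix n
  let ?A = "\<lambda>k. {i\<in>I. e i = int k}" and ?B = "\<lambda>k. {j\<in>J. f j = int k}"
  have "fps_nth (msum I c e * msum J d f) n
      = (\<Sum>k=0..n. (\<Sum>i\<in>?A k. c i) * (\<Sum>j\<in>?B (n - k). d j))"
    by (simp add: fps_mult_nth msum_nth)
  also have "\<dots> = (\<Sum>k=0..n. \<Sum>p\<in>?A k \<times> ?B (n - k). c (fst p) * d (snd p))"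
    by (simp add: sum_product sum.cartesian_product case_prod_unfold)
  also have "\<dots> = (\<Sum>p\<in>(\<Union>k\<in>{0..n}. ?A k \<times> ?B (n - k)). c (fst p) * d (snd p))"
    by (rule sum.UNION_disjoint [symmetric])
       (auto intro: admissible_finite_eq[OF assms(1)] admissible_finite_eq[OF assms(2)])
  also have "(\<Union>k\<in>{0..n}. ?A k \<times> ?B (n - k))
      = {p \<in> I \<times> J. (case p of (i, j) \<Rightarrow> e i + f j) = int n}" (is "?L = ?R")
  proof
    show "?L \<subseteq> ?R" by auto
    show "?R \<subseteq> ?L"
    proof clarify
      fix i j assume *: "i \<in> I" "j \<in> J" "e i + f j = int n"
      \<comment> \<open>Nonnegativity keeps \<open>e i\<close> between 0 and n, so every pair occurs
        in the Cauchy product.\<close>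
      then have "0 \<le> e i" "0 \<le> f j" using assms by (auto simp: admissible_def)
      then show "(i, j) \<in> ?L"
        using * by (intro UN_I[of "nat (e i)"]) auto
    qed
  qed
  finally show "fps_nth (msum I c e * msum J d f) n
      = fps_nth (msum (I \<times> J) (\<lambda>(i, j). c i * d j) (\<lambda>(i, j). e i + f j)) n"
    by (simp add: msum_nth case_prod_unfold)
qed

lemma msum_reindex:
  assumes "bij_betw h J I" "\<And>j. j \<in> J \<Longrightarrow> c (h j) = d j" "\<And>j. j \<in> J \<Longrightarrow> e (h j) = f j"
  shows "msum I c e = msum J d f"
proof (rule fps_ext)
  fix n
  have "bij_betw h {j\<in>J. f j = int n} {i\<in>I. e i = int n}"
    using assms(1,3) unfolding bij_betw_def inj_on_def by (auto simp: image_iff)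
  then have "(\<Sum>i\<in>{i\<in>I. e i = int n}. c i) = (\<Sum>j\<in>{j\<in>J. f j = int n}. c (h j))"
    by (rule sum.reindex_bij_betw [symmetric])
  also have "\<dots> = (\<Sum>j\<in>{j\<in>J. f j = int n}. d j)"
    by (rule sum.cong) (simp_all add: assms(2))
  finally show "fps_nth (msum I c e) n = fps_nth (msum J d f) n"
    by (simp add: msum_nth)
qed

lemma msum_cong:
  assumes "\<And>i. i \<in> I \<Longrightarrow> c i = d i" "\<And>i. i \<in> I \<Longrightarrow> e i = f i"
  shows "msum I c e = msum I d f"
  by (rule msum_reindex[of id]) (simp_all add: assms)

lemma msum_Un:
  assumes "admissible (I \<union> J) e" "I \<inter> J = {}"
  shows "msum (I \<union> J) c e = msum I c e + msum J c e"
proof (rule fps_ext)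
  fix n
  have "{i \<in> I \<union> J. e i = int n} = {i\<in>I. e i = int n} \<union> {i\<in>J. e i = int n}" by auto
  moreover have "admissible I e" "admissible J e"
    by (auto intro: admissible_subset[OF assms(1)])
  ultimately show "fps_nth (msum (I \<union> J) c e) n = fps_nth (msum I c e + msum J c e) n"
    using assms(2) by (simp add: msum_nth sum.union_disjoint admissible_finite_eq disjoint_iff)
qed

lemma msum_uminus: "msum I (\<lambda>i. - c i) e = - msum I c e"
  by (rule fps_ext) (simp add: msum_nth sum_negf)

text \<open>Nonnegative exponents ensure that the shift does not bring back terms dropped by
  \<open>msum I c e\<close>.\<close>

lemma msum_shift:
  assumes "\<And>i. i \<in> I \<Longrightarrow> 0 \<le> e i"
  shows "msum I c (\<lambda>i. e i + int k) = fps_X ^ k * msum I c e"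
proof (rule fps_ext)
  fix n
  show "fps_nth (msum I c (\<lambda>i. e i + int k)) n = fps_nth (fps_X ^ k * msum I c e) n"
  proof (cases "n < k")
    case True
    then have "{i\<in>I. e i + int k = int n} = {}" using assms by force
    then show ?thesis
      unfolding msum_nth using True by (simp only: sum.empty fps_X_power_mult_nth if_True)
  next
    case False
    then have "{i\<in>I. e i + int k = int n} = {i\<in>I. e i = int (n - k)}" by auto
    then show ?thesis using False by (simp add: msum_nth fps_X_power_mult_nth)
  qed
qed

section \<open>Theta series and the triple product\<close>

definition theta :: "'a::comm_ring_1 \<Rightarrow> 'a \<Rightarrow> int \<Rightarrow> int \<Rightarrow> 'a fps"
  where "theta x y u v = msum UNIV (zpow x y) (\<lambda>n. u * n\<^sup>2 + v * n)"

text \<open>This bound makes theta exponents admissible; for nonzero n it rests on u |n| - |v| being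
  at least 1.\<close>

lemma theta_exponent_ge:
  fixes u v n :: int
  assumes "\<bar>v\<bar> < u"
  shows "\<bar>n\<bar> \<le> u * n\<^sup>2 + v * n"
proof -
  have "\<bar>n\<bar> * 1 \<le> \<bar>n\<bar> * (u * \<bar>n\<bar> - \<bar>v\<bar>)"
  proof (cases "n = 0")
    case False
    then have "u * 1 \<le> u * \<bar>n\<bar>" using assms by (intro mult_left_mono) auto
    then show ?thesis using assms by (intro mult_left_mono) auto
  qed simp
  also have "\<dots> = u * (\<bar>n\<bar> * \<bar>n\<bar>) - \<bar>v * n\<bar>"
    by (simp only: right_diff_distrib abs_mult mult_ac)
  also have "\<dots> = u * n\<^sup>2 - \<bar>v * n\<bar>"
    by (simp only: abs_mult_self_eq power2_eq_square)
  finally show ?thesis by linarith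
qed

text \<open>The extra top term vanishes; splitting off \<open>f 0\<close> aligns the sum with
  \<open>f (Suc i)\<close>, ready for a q-Pascal rule.\<close>

lemma qbinom_sum_shift:
  "(\<Sum>i\<le>N. qbinom Q N i * f i) = f 0 + (\<Sum>i\<le>N. qbinom Q N (Suc i) * f (Suc i))"
proof -
  have "(\<Sum>i\<le>N. qbinom Q N i * f i) = (\<Sum>i\<le>Suc N. qbinom Q N i * f i)"
    by (simp add: qbinom_eq_0)
  also have "\<dots> = f 0 + (\<Sum>i\<le>N. qbinom Q N (Suc i) * f (Suc i))"
    by (subst sum.atMost_Suc_shift) simp
  finally show ?thesis .
qed

context
  fixes x y :: "'a::comm_ring_1" and u v :: int
  assumes xy: "x * y = 1" and uv: "\<bar>v\<bar> < u"
begin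

private definition e where "e n = u * n\<^sup>2 + v * n"
private definition t where "t j = fps_const (zpow x y j) * fps_X ^ nat (e j)"
private definition a where "a = fps_const x * fps_X ^ nat (u + v)"
private definition b where "b = fps_const y * fps_X ^ nat (u - v)"
private definition r where "r = nat (2 * u)"
private definition Q where "Q = (fps_X ^ r :: 'a fps)"

private lemma e_ge: "\<bar>n\<bar> \<le> e n"
  unfolding e_def by (rule theta_exponent_ge[OF uv])

private lemma e_nonneg: "0 \<le> e n"
  using e_ge[of n] by linarith

text \<open>Passing to the next theta term raises the exponent by u (2 j + 1) + v, which
  \<open>a\<close> and the powers of \<open>Q\<close> account for.\<close>

private lemma t_a:
  assumes "i \<le> m + n"
  shows "a * fps_X ^ (r * m) * t (int i - int n) = Q ^ (m + n - i) * t (int (Suc i) - int n)"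
proof -
  define j where "j = int i - int n"
  have j': "int (Suc i) - int n = j + 1" by (simp add: j_def)
  have "int (nat (u + v) + r * m + nat (e j)) = int (r * (m + n - i) + nat (e (j + 1)))"
    using uv e_nonneg[of j] e_nonneg[of "j + 1"] assms
    by (simp add: r_def of_nat_diff) (simp add: e_def j_def algebra_simps power2_eq_square)
  then have "nat (u + v) + r * m + nat (e j) = r * (m + n - i) + nat (e (j + 1))"
    by (simp only: of_nat_eq_iff)
  then have "fps_X ^ nat (u + v) * fps_X ^ (r * m) * fps_X ^ nat (e j)
      = (fps_X ^ r) ^ (m + n - i) * (fps_X ^ nat (e (j + 1)) :: 'a fps)"
    by (simp only: power_add [symmetric] power_mult [symmetric])
  then have "fps_const (x * zpow x y j) * (fps_X ^ nat (u + v) * fps_X ^ (r * m) * fps_X ^ nat (e j))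
      = (fps_X ^ r) ^ (m + n - i) * (fps_const (x * zpow x y j) * fps_X ^ nat (e (j + 1)))"
    by (simp only: mult_ac)
  then show ?thesis
    unfolding j' unfolding j_def [symmetric] a_def t_def Q_def zpow_add_1[OF xy]
    by (simp only: fps_const_mult [symmetric] mult_ac)
qed

private lemma t_b:
  "b * fps_X ^ (r * n) * t (int i - int n) = Q ^ i * t (int i - int (Suc n))"
proof -
  define j where "j = int i - int n"
  have j': "int i - int (Suc n) = j - 1" by (simp add: j_def)
  have "int (nat (u - v) + r * n + nat (e j)) = int (r * i + nat (e (j - 1)))"
    using uv e_nonneg[of j] e_nonneg[of "j - 1"]
    by (simp add: r_def) (simp add: e_def j_def algebra_simps power2_eq_square)
  then have "nat (u - v) + r * n + nat (e j) = r * i + nat (e (j - 1))"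
    by (simp only: of_nat_eq_iff)
  then have "fps_X ^ nat (u - v) * fps_X ^ (r * n) * fps_X ^ nat (e j)
      = (fps_X ^ r) ^ i * (fps_X ^ nat (e (j - 1)) :: 'a fps)"
    by (simp only: power_add [symmetric] power_mult [symmetric])
  then have "fps_const (y * zpow x y j) * (fps_X ^ nat (u - v) * fps_X ^ (r * n) * fps_X ^ nat (e j))
      = (fps_X ^ r) ^ i * (fps_const (y * zpow x y j) * fps_X ^ nat (e (j - 1)))"
    by (simp only: mult_ac)
  then show ?thesis
    unfolding j' unfolding j_def [symmetric] b_def t_def Q_def zpow_diff_1[OF xy]
    by (simp only: fps_const_mult [symmetric] mult_ac)
qed

text \<open>
  Allowing different numbers of factors of the two kinds makes this a one-step induction that uses
  one \<open>q\<close>-Pascal rule for each kind.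
\<close>

private lemma finite_triple_product:
  "qpoch (- a) r m * qpoch (- b) r n = (\<Sum>i\<le>m+n. qbinom Q (m + n) i * t (int i - int n))"
proof (induction n)
  case 0
  show ?case
  proof (induction m)
    case 0
    then show ?case by (simp add: t_def e_def)
  next
    case (Suc m)
    let ?t = "\<lambda>i. t (int i - int 0)"
    have "qpoch (- a) r (Suc m) * qpoch (- b) r 0
        = (\<Sum>i\<le>m. qbinom Q m i * ?t i) + (\<Sum>i\<le>m. qbinom Q m i * (a * fps_X ^ (r * m) * ?t i))"
      using Suc.IH
      by (simp add: qpoch_Suc distrib_left sum_distrib_left sum_distrib_right sum.distrib mult_ac)
    also have "(\<Sum>i\<le>m. qbinom Q m i * (a * fps_X ^ (r * m) * ?t i))
        = (\<Sum>i\<le>m. Q ^ (m - i) * qbinom Q m i * ?t (Suc i))"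
    proof (rule sum.cong[OF refl])
      fix i assume "i \<in> {..m}"
      then show "qbinom Q m i * (a * fps_X ^ (r * m) * ?t i)
          = Q ^ (m - i) * qbinom Q m i * ?t (Suc i)"
        using t_a[of i m 0] by (simp only: add_0_right atMost_iff mult_ac)
    qed
    also have "(\<Sum>i\<le>m. qbinom Q m i * ?t i) + (\<Sum>i\<le>m. Q ^ (m - i) * qbinom Q m i * ?t (Suc i))
       = ?t 0 + (\<Sum>i\<le>m. (Q ^ (m - i) * qbinom Q m i + qbinom Q m (Suc i)) * ?t (Suc i))"
      unfolding qbinom_sum_shift[of Q m ?t] by (simp only: sum.distrib distrib_right add_ac)
    also have "\<dots> = ?t 0 + (\<Sum>i\<le>m. qbinom Q (Suc m) (Suc i) * ?t (Suc i))"
      by (intro arg_cong2[where f = "(+)"] sum.cong refl) (simp only: atMost_iff qbinom_Suc_Suc')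
    also have "\<dots> = (\<Sum>i\<le>Suc m. qbinom Q (Suc m) i * ?t i)"
      by (subst sum.atMost_Suc_shift) simp
    finally show ?case by simp
  qed
next
  case (Suc n)
  let ?t = "\<lambda>i. t (int i - int (Suc n))" and ?N = "m + n"
  have tS: "t (int i - int n) = ?t (Suc i)" for i by simp
  have "qpoch (- a) r m * qpoch (- b) r (Suc n)
      = (qpoch (- a) r m * qpoch (- b) r n) * (1 + b * fps_X ^ (r * n))"
    by (simp add: qpoch_Suc mult_ac)
  also have "\<dots> = (\<Sum>i\<le>?N. qbinom Q ?N i * ?t (Suc i))
      + (\<Sum>i\<le>?N. qbinom Q ?N i * (b * fps_X ^ (r * n) * t (int i - int n)))"
    unfolding Suc.IH
    by (simp add: distrib_left sum_distrib_left sum_distrib_right sum.distrib mult_ac)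
  also have "(\<Sum>i\<le>?N. qbinom Q ?N i * (b * fps_X ^ (r * n) * t (int i - int n)))
      = (\<Sum>i\<le>?N. qbinom Q ?N i * (Q ^ i * ?t i))"
    unfolding t_b ..
  also have "\<dots> = ?t 0 + (\<Sum>i\<le>?N. qbinom Q ?N (Suc i) * (Q ^ Suc i * ?t (Suc i)))"
    unfolding qbinom_sum_shift[of Q ?N "\<lambda>i. Q ^ i * ?t i"] by simp
  also have "(\<Sum>i\<le>?N. qbinom Q ?N i * ?t (Suc i)) + \<dots>
      = ?t 0 + (\<Sum>i\<le>?N. (qbinom Q ?N i + Q ^ Suc i * qbinom Q ?N (Suc i)) * ?t (Suc i))"
    unfolding distrib_right sum.distrib by (simp only: add_ac mult_ac)
  also have "\<dots> = (\<Sum>i\<le>Suc ?N. qbinom Q (Suc ?N) i * ?t i)"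
    by (subst sum.atMost_Suc_shift) (simp only: qbinom.simps mult_1_left)
  finally show ?case by (simp only: add_Suc_right)
qed

text \<open>As \<open>e j\<close> is at least |j|, every term that matters below precision
  \<open>M\<close> lies in the window from -n to n.\<close>

private lemma eqmod_finite_theta:
  assumes "n \<ge> M"
  shows "eqmod M (\<Sum>i\<le>n+n. t (int i - int n)) (theta x y u v)"
  unfolding eqmod_def
proof (intro allI impI)
  fix k assume k: "k < M"
  have 1: "fps_nth (t j) k = (if e j = int k then zpow x y j else 0)" for j
    using e_nonneg[of j] by (auto simp: t_def)
  have "bij_betw (\<lambda>i. int i - int n) {i\<in>{..n+n}. e (int i - int n) = int k} {j. e j = int k}"
    unfolding bij_betw_def
  proof
    show "(\<lambda>i. int i - int n) ` {i\<in>{..n+n}. e (int i - int n) = int k} = {j. e j = int k}"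
    proof (intro equalityI subsetI)
      fix j assume j: "j \<in> {j. e j = int k}"
      then have "\<bar>j\<bar> \<le> int n" using e_ge[of j] k assms by auto
      then show "j \<in> (\<lambda>i. int i - int n) ` {i\<in>{..n+n}. e (int i - int n) = int k}"
        using j by (intro image_eqI[of _ _ "nat (j + int n)"]) auto
    qed auto
  qed (auto simp: inj_on_def)
  then have "(\<Sum>j\<in>{j. e j = int k}. zpow x y j)
      = (\<Sum>i\<in>{i\<in>{..n+n}. e (int i - int n) = int k}. zpow x y (int i - int n))"
    by (rule sum.reindex_bij_betw [symmetric])
  also have "\<dots> = (\<Sum>i\<le>n+n. if e (int i - int n) = int k then zpow x y (int i - int n) else 0)"
    by (rule sum.inter_filter) simp
  finally show "fps_nth (\<Sum>i\<le>n+n. t (int i - int n)) k = fps_nth (theta x y u v) k"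
    by (simp add: fps_sum_nth 1 theta_def msum_nth e_def)
qed

private lemma eqmod_mult_t:
  assumes "int M \<le> \<bar>j\<bar>"
  shows "eqmod M (g * t j) 0"
proof -
  have "M \<le> nat (e j)" using e_ge[of j] assms by linarith
  moreover have "g * t j = (g * fps_const (zpow x y j)) * fps_X ^ nat (e j)"
    by (simp add: t_def mult_ac)
  ultimately show ?thesis
    by (simp add: eqmod_def fps_X_power_mult_right_nth)
qed

text \<open>Take equally many factors of both kinds in the finite product and multiply by
  \<open>qpoch_inf Q r\<close>: modulo q^M the central binomials become 1 and the outer terms
  vanish.\<close>

theorem Jacobi_triple_product:
  "theta x y u v = qpoch_inf (fps_X ^ nat (2 * u)) (nat (2 * u))
     * (qpoch_inf (- (fps_const x * fps_X ^ nat (u + v))) (nat (2 * u))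
      * qpoch_inf (- (fps_const y * fps_X ^ nat (u - v))) (nat (2 * u)))"
proof -
  have r: "r > 0" and a0: "fps_nth (- a) 0 = 0" and b0: "fps_nth (- b) 0 = 0"
    using uv by (auto simp: r_def a_def b_def)
  have "qpoch_inf Q r * (qpoch_inf (- a) r * qpoch_inf (- b) r) = theta x y u v"
  proof (rule eqmod_imp_eq)
    fix M :: nat
    \<comment> \<open>With this choice, |i - n| < M leaves both i and 2 n - i at least M, as
      \<open>eqmod_qbinom\<close> requires.\<close>
    define n where "n = M + M"
    have "eqmod M (qpoch_inf Q r * (qpoch_inf (- a) r * qpoch_inf (- b) r))
       (qpoch_inf Q r * (qpoch (- a) r n * qpoch (- b) r n))"
      by (intro eqmod_mult eqmod_refl eqmod_sym[OF eqmod_qpoch_inf] a0 b0 r) (simp_all add: n_def)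
    also have "\<dots> = (\<Sum>i\<le>n+n. qpoch_inf Q r * qbinom Q (n + n) i * t (int i - int n))"
      unfolding finite_triple_product by (simp only: sum_distrib_left mult.assoc)
    also have "eqmod M \<dots> (\<Sum>i\<le>n+n. t (int i - int n))"
    proof (rule eqmod_sum)
      fix i assume i: "i \<in> {..n+n}"
      show "eqmod M (qpoch_inf Q r * qbinom Q (n + n) i * t (int i - int n)) (t (int i - int n))"
      proof (cases "int M \<le> \<bar>int i - int n\<bar>")
        case True
        from eqmod_sym[OF eqmod_mult_t[OF this, of 1]] have "eqmod M 0 (t (int i - int n))"
          by simp
        with eqmod_mult_t[OF True] show ?thesis by (rule eqmod_trans)
      next
        case False
        then have "M \<le> i" "M \<le> n + n - i" "i + (n + n - i) = n + n"
          using i by (auto simp: n_def)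
        with eqmod_qbinom[OF r, of M i "n + n - i"]
        have "eqmod M (qpoch_inf Q r * qbinom Q (n + n) i) 1" by (simp add: Q_def)
        from eqmod_mult[OF this eqmod_refl] show ?thesis by simp
      qed
    qed
    also have "eqmod M \<dots> (theta x y u v)"
      by (rule eqmod_finite_theta) (simp add: n_def)
    finally show "eqmod M (qpoch_inf Q r * (qpoch_inf (- a) r * qpoch_inf (- b) r)) (theta x y u v)" .
  qed
  then show ?thesis by (simp add: Q_def a_def b_def r_def)
qed

end

section \<open>Cubes of theta series\<close>

text \<open>
  Rounding \<open>(n\<^sup>2 + 2) / 3\<close> down gives \<open>n\<^sup>2 / 3\<close> for \<open>3 dvd n\<close> and the exact quotient otherwise, so
  both halves of the dissection share one exponent.
\<close>

definition theta0 :: "'a::comm_ring_1 \<Rightarrow> 'a \<Rightarrow> int \<Rightarrow> int \<Rightarrow> 'a fps"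
  where "theta0 x y u v = msum {n. 3 dvd n} (zpow x y) (\<lambda>n. u * ((n\<^sup>2 + 2) div 3) + v * n)"

definition theta1 :: "'a::comm_ring_1 \<Rightarrow> 'a \<Rightarrow> int \<Rightarrow> int \<Rightarrow> 'a fps"
  where "theta1 x y u v = msum {n. \<not> 3 dvd n} (zpow x y) (\<lambda>n. u * ((n\<^sup>2 + 2) div 3) + v * n)"

text \<open>
  The sums of \<open>q\<^bsup>u(i\<^sup>2 + j\<^sup>2 + l\<^sup>2)\<^esup>\<close> over \<open>i + j + l = 0\<close> and over \<open>i + j + l = 1\<close>, the latter divided by
  \<open>q\<^bsup>u\<^esup>\<close>.
\<close>

definition cubic_a :: "int \<Rightarrow> 'a::comm_ring_1 fps"
  where "cubic_a u = msum UNIV (\<lambda>_. 1) (\<lambda>(i, j). u * (i\<^sup>2 + j\<^sup>2 + (i + j)\<^sup>2))"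

definition cubic_c :: "int \<Rightarrow> 'a::comm_ring_1 fps"
  where "cubic_c u = msum UNIV (\<lambda>_. 1) (\<lambda>(i, j). u * (i\<^sup>2 + j\<^sup>2 + (1 - i - j)\<^sup>2 - 1))"

lemma int_mod_3_cases:
  fixes n :: int
  obtains k where "n = 3 * k" | k where "n = 3 * k + 1" | k where "n = 3 * k - 1"
proof -
  have "n mod 3 = 0 \<or> n mod 3 = 1 \<or> n mod 3 = 2" by presburger
  then show ?thesis
  proof (elim disjE)
    assume "n mod 3 = 0"
    then have "n = 3 * (n div 3)" by presburger
    then show ?thesis by (rule that(1))
  next
    assume "n mod 3 = 1"
    then have "n = 3 * (n div 3) + 1" by presburger
    then show ?thesis by (rule that(2))
  next
    assume "n mod 3 = 2"
    then have "n = 3 * (n div 3 + 1) - 1" by presburger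
    then show ?thesis by (rule that(3))
  qed
qed

lemma third_of_square:
  fixes k :: int
  shows "((3 * k)\<^sup>2 + 2) div 3 = 3 * k\<^sup>2"
    and "((3 * k + 1)\<^sup>2 + 2) div 3 = 3 * k\<^sup>2 + 2 * k + 1"
    and "((3 * k - 1)\<^sup>2 + 2) div 3 = 3 * k\<^sup>2 - 2 * k + 1"
proof -
  have "(3 * k)\<^sup>2 + 2 = 3 * (3 * k\<^sup>2) + 2"
    "(3 * k + 1)\<^sup>2 + 2 = 3 * (3 * k\<^sup>2 + 2 * k + 1)"
    "(3 * k - 1)\<^sup>2 + 2 = 3 * (3 * k\<^sup>2 - 2 * k + 1)"
    by (simp_all add: power2_eq_square algebra_simps)
  then show "((3 * k)\<^sup>2 + 2) div 3 = 3 * k\<^sup>2"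
    "((3 * k + 1)\<^sup>2 + 2) div 3 = 3 * k\<^sup>2 + 2 * k + 1"
    "((3 * k - 1)\<^sup>2 + 2) div 3 = 3 * k\<^sup>2 - 2 * k + 1"
    by simp_all
qed

lemma abs_le_third_of_square: "\<bar>n\<bar> \<le> (n\<^sup>2 + 2) div (3::int)"
proof -
  have sq: "\<bar>k\<bar> \<le> k\<^sup>2" for k :: int
    using theta_exponent_ge[of 0 1 k] by simp
  have sq': "2 * \<bar>k\<bar> - 1 \<le> k\<^sup>2" for k :: int
    using zero_le_power2[of "\<bar>k\<bar> - 1"] by (simp add: power2_diff)
  show ?thesis
  proof (cases n rule: int_mod_3_cases)
    case (1 k)
    show ?thesis using sq[of k] unfolding 1 third_of_square by linarith
  next
    case (2 k)
    show ?thesis using sq[of k] sq'[of k] unfolding 2 third_of_square by linarith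
  next
    case (3 k)
    show ?thesis using sq[of k] sq'[of k] unfolding 3 third_of_square by linarith
  qed
qed

lemma admissible_theta: "\<bar>v\<bar> < u \<Longrightarrow> admissible I (\<lambda>n. u * n\<^sup>2 + v * n)"
  by (rule admissible_int) (rule theta_exponent_ge)

lemma admissible_theta01:
  fixes u v :: int
  assumes "\<bar>v\<bar> < u"
  shows "admissible I (\<lambda>n. u * ((n\<^sup>2 + 2) div 3) + v * n)"
proof (rule admissible_int)
  fix n :: int
  let ?s = "(n\<^sup>2 + 2) div 3"
  have s: "\<bar>n\<bar> \<le> ?s" by (rule abs_le_third_of_square)
  have "\<bar>v\<bar> * \<bar>n\<bar> \<le> \<bar>v\<bar> * ?s" using s by (intro mult_left_mono) auto
  moreover have "(\<bar>v\<bar> + 1) * ?s \<le> u * ?s" using s assms by (intro mult_right_mono) auto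
  moreover have "- (\<bar>v\<bar> * \<bar>n\<bar>) \<le> v * n"
    by (metis abs_mult abs_ge_minus_self minus_le_iff)
  ultimately show "\<bar>n\<bar> \<le> u * ?s + v * n"
    using s by (simp add: distrib_right)
qed

lemma abs_le_mult_add_1:
  fixes i s u :: int
  assumes "0 < u" "0 \<le> s" "\<bar>i\<bar> \<le> s + 1"
  shows "\<bar>i\<bar> \<le> u * s + 1"
  using mult_right_mono[of 1 u s] assms by linarith

lemma admissible_cubic_a:
  fixes u :: int
  assumes "0 < u"
  shows "admissible UNIV (\<lambda>(i, j). u * (i\<^sup>2 + j\<^sup>2 + (i + j)\<^sup>2))"
proof -
  have *: "0 \<le> i\<^sup>2 + j\<^sup>2 + (i + j)\<^sup>2 \<and> \<bar>i\<bar> \<le> i\<^sup>2 + j\<^sup>2 + (i + j)\<^sup>2 + 1 \<and> \<bar>j\<bar> \<le> i\<^sup>2 + j\<^sup>2 + (i + j)\<^sup>2 + 1" for i j :: int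
  proof -
    have "\<bar>k\<bar> \<le> k\<^sup>2" for k :: int
      using theta_exponent_ge[of 0 1 k] by simp
    from this[of i] this[of j] this[of "i + j"] show ?thesis by linarith
  qed
  show ?thesis
    by (rule admissible_pairs; unfold prod.case)
       (use * assms abs_le_mult_add_1 in \<open>blast intro: mult_nonneg_nonneg less_imp_le\<close>)+
qed

lemma admissible_cubic_c:
  fixes u :: int
  assumes "0 < u"
  shows "admissible UNIV (\<lambda>(i, j). u * (i\<^sup>2 + j\<^sup>2 + (1 - i - j)\<^sup>2 - 1))"
proof -
  have *: "0 \<le> i\<^sup>2 + j\<^sup>2 + (1 - i - j)\<^sup>2 - 1 \<and> \<bar>i\<bar> \<le> i\<^sup>2 + j\<^sup>2 + (1 - i - j)\<^sup>2 - 1 + 1 \<and> \<bar>j\<bar> \<le> i\<^sup>2 + j\<^sup>2 + (1 - i - j)\<^sup>2 - 1 + 1" for i j :: int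
  proof -
    have "\<bar>k\<bar> \<le> k\<^sup>2" for k :: int
      using theta_exponent_ge[of 0 1 k] by simp
    from this[of i] this[of j] this[of "1 - i - j"] show ?thesis by linarith
  qed
  show ?thesis
    by (rule admissible_pairs; unfold prod.case)
       (use * assms abs_le_mult_add_1 in \<open>blast intro: mult_nonneg_nonneg less_imp_le\<close>)+
qed

text \<open>
  A triple with sum \<open>n = 3 k + r\<close>, \<open>r \<in> {-1, 0, 1}\<close>, is translated by \<open>-k\<close> to a triple with sum \<open>r\<close>, and
  reflected if \<open>r = -1\<close>.
\<close>

theorem theta_cubed:
  fixes x y :: "'a::comm_ring_1"
  assumes xy: "x * y = 1" and uv: "\<bar>v\<bar> < u"
  shows "theta x y u v ^ 3 = cubic_a u * theta0 x y u v + cubic_c u * theta1 x y u v"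
proof -
  define e where "e = (\<lambda>n::int. u * n\<^sup>2 + v * n)"
  define c where "c = (\<lambda>((i, j), l). zpow x y i * zpow x y j * zpow x y l)"
  define d where "d = (\<lambda>((i, j), l). e i + e j + e l)"
  define A :: "((int \<times> int) \<times> int) set" where "A = {((i, j), l). 3 dvd i + j + l}"
  define B :: "((int \<times> int) \<times> int) set" where "B = {((i, j), l). \<not> 3 dvd i + j + l}"
  have ade: "admissible UNIV e"
    unfolding e_def by (rule admissible_theta[OF uv])
  have AB: "A \<union> B = UNIV" "A \<inter> B = {}" by (auto simp: A_def B_def)
  have u: "0 < u" using uv by linarith
  have zadd: "zpow x y i * zpow x y j * zpow x y l = zpow x y (i + j + l)" for i j l
    by (simp add: zpow_add[OF xy])
  have "theta x y u v ^ 3 = msum UNIV (zpow x y) e * msum UNIV (zpow x y) e * msum UNIV (zpow x y) e"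
    by (simp add: power3_eq_cube theta_def e_def)
  also have "\<dots> = msum ((UNIV \<times> UNIV) \<times> UNIV) c d"
    unfolding msum_mult[OF ade ade] msum_mult[OF admissible_Times[OF ade ade] ade]
    by (rule msum_cong) (auto simp: c_def d_def)
  also have "\<dots> = msum (A \<union> B) c d"
    by (simp add: AB)
  also have "\<dots> = msum A c d + msum B c d"
  proof (rule msum_Un)
    have "admissible ((UNIV \<times> UNIV) \<times> UNIV) d"
      using admissible_Times[OF admissible_Times[OF ade ade] ade]
      by (simp add: d_def case_prod_unfold)
    then show "admissible (A \<union> B) d" by (simp add: AB)
  qed (rule AB)
  also have "msum A c d = cubic_a u * theta0 x y u v"
    unfolding cubic_a_def theta0_def
      msum_mult[OF admissible_cubic_a[OF u] admissible_theta01[OF uv]]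
  proof (rule msum_reindex)
    \<comment> \<open>Translation of (i, j, -i - j) by n/3; since that triple sums to 0, the cross
      terms in the sum of squares cancel.\<close>
    let ?h = "\<lambda>((i, j), n). ((n div 3 + i, n div 3 + j), n div 3 - i - j) :: (int \<times> int) \<times> int"
    show "bij_betw ?h (UNIV \<times> {n. 3 dvd n}) A"
      by (rule bij_betw_byWitness[of _ "\<lambda>((i, j), l). let n = i + j + l in
            ((i - n div 3, j - n div 3), n)"])
         (auto simp: A_def Let_def elim!: dvdE)
    fix p :: "(int \<times> int) \<times> int" assume "p \<in> UNIV \<times> {n. 3 dvd n}"
    then obtain i j k where p: "p = ((i, j), 3 * k)" by (cases p) (auto elim!: dvdE)
    show "c (?h p) = (case p of (p, n) \<Rightarrow> 1 * zpow x y n)"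
      unfolding p c_def prod.case zadd by simp
    show "d (?h p) = (case p of (p, n) \<Rightarrow> (case p of (i, j) \<Rightarrow> u * (i\<^sup>2 + j\<^sup>2 + (i + j)\<^sup>2))
            + (u * ((n\<^sup>2 + 2) div 3) + v * n))"
      unfolding p d_def e_def prod.case third_of_square
      by (simp add: power2_eq_square algebra_simps)
  qed
  also have "msum B c d = cubic_c u * theta1 x y u v"
    unfolding cubic_c_def theta1_def
      msum_mult[OF admissible_cubic_c[OF u] admissible_theta01[OF uv]]
  proof (rule msum_reindex)
    \<comment> \<open>\<open>k n\<close> is the integer nearest to n/3 and \<open>r n\<close> the
      signed residue, which is 1 or -1 when 3 does not divide n.\<close>
    define k where "k n = (n + 1) div 3" for n :: int
    define r where "r n = n - 3 * k n" for n :: int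
    have k_cases: "k (3 * m + 1) = m" "k (3 * m - 1) = m" for m
      by (simp_all add: k_def)
    have r_cases: "r (3 * m + 1) = 1" "r (3 * m - 1) = -1" for m
      by (simp_all only: r_def k_cases)
    \<comment> \<open>A sign is its own inverse; this makes \<open>?g\<close> and \<open>?h\<close>
      mutually inverse.\<close>
    have rr: "r n * (r n * m) = m" if "\<not> 3 dvd n" for n m
      using that by (cases n rule: int_mod_3_cases) (simp_all add: r_cases)
    let ?h = "\<lambda>((i, j), n). ((k n + r n * i, k n + r n * j), k n + r n * (1 - i - j))"
    have h_sum: "k n + r n * i + (k n + r n * j) + (k n + r n * (1 - i - j)) = n" for n i j
      by (simp add: r_def algebra_simps)
    let ?g = "\<lambda>((i, j), l). let n = i + j + l in ((r n * (i - k n), r n * (j - k n)), n)"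
    show "bij_betw ?h (UNIV \<times> {n. \<not> 3 dvd n}) B"
    proof (rule bij_betw_byWitness[of _ ?g])
      show "\<forall>p\<in>UNIV \<times> {n. \<not> 3 dvd n}. ?g (?h p) = p"
      proof
        fix p :: "(int \<times> int) \<times> int" assume "p \<in> UNIV \<times> {n. \<not> 3 dvd n}"
        then obtain i j n where p: "p = ((i, j), n)" and n: "\<not> 3 dvd n" by (cases p) auto
        show "?g (?h p) = p"
          unfolding p by (simp only: prod.case Let_def h_sum) (simp add: rr[OF n])
      qed
      show "\<forall>p\<in>B. ?h (?g p) = p"
      proof
        fix p assume "p \<in> B"
        then obtain i j l where p: "p = ((i, j), l)" and n: "\<not> 3 dvd i + j + l"
          by (cases p) (auto simp: B_def)
        let ?n = "i + j + l"
        have "k ?n + r ?n * (1 - r ?n * (i - k ?n) - r ?n * (j - k ?n))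
            = k ?n + r ?n - r ?n * (r ?n * (i - k ?n)) - r ?n * (r ?n * (j - k ?n))"
          by (simp add: algebra_simps)
        also have "\<dots> = l"
          unfolding rr[OF n] by (simp add: r_def)
        finally show "?h (?g p) = p"
          by (simp add: p Let_def rr[OF n])
      qed
      show "?h ` (UNIV \<times> {n. \<not> 3 dvd n}) \<subseteq> B"
      proof (rule image_subsetI)
        fix p :: "(int \<times> int) \<times> int" assume "p \<in> UNIV \<times> {n. \<not> 3 dvd n}"
        then obtain i j n where p: "p = ((i, j), n)" and n: "\<not> 3 dvd n" by (cases p) auto
        show "?h p \<in> B"
          unfolding p B_def mem_Collect_eq prod.case h_sum by (rule n)
      qed
      show "?g ` B \<subseteq> UNIV \<times> {n. \<not> 3 dvd n}"
        by (auto simp: B_def Let_def)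
    qed
    fix p :: "(int \<times> int) \<times> int" assume "p \<in> UNIV \<times> {n. \<not> 3 dvd n}"
    then obtain i j n where p: "p = ((i, j), n)" and n: "\<not> 3 dvd n" by (cases p) auto
    show "c (?h p) = (case p of (p, n) \<Rightarrow> 1 * zpow x y n)"
      unfolding p c_def prod.case zadd h_sum by simp
    \<comment> \<open>The \<open>- 1\<close> in the exponent of \<open>cubic_c\<close> offsets the
      constant 1 in \<open>third_of_square\<close>.\<close>
    show "d (?h p) = (case p of (p, n) \<Rightarrow> (case p of (i, j) \<Rightarrow> u * (i\<^sup>2 + j\<^sup>2 + (1 - i - j)\<^sup>2 - 1))
            + (u * ((n\<^sup>2 + 2) div 3) + v * n))"
    proof (cases n rule: int_mod_3_cases)
      case (2 m)
      then show ?thesis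
        unfolding p 2 d_def e_def prod.case third_of_square k_cases r_cases
        by (simp add: power2_eq_square algebra_simps)
    next
      case (3 m)
      then show ?thesis
        unfolding p 3 d_def e_def prod.case third_of_square k_cases r_cases
        by (simp add: power2_eq_square algebra_simps)
    qed (use n in simp)
  qed
  finally show ?thesis .
qed

section \<open>Sections modulo 3\<close>

text \<open>The 3-dissection of f reads (sec 0 f)(q^3) + q (sec 1 f)(q^3) + q^2 (sec 2
  f)(q^3).\<close>

definition sec :: "nat \<Rightarrow> 'a fps \<Rightarrow> 'a fps"
  where "sec r f = Abs_fps (\<lambda>n. fps_nth f (3 * n + r))"

lemma sec_nth [simp]: "fps_nth (sec r f) n = fps_nth f (3 * n + r)"
  by (simp add: sec_def)

lemma unitize_3: "unitize 3 f = sec 0 f"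
  by (simp add: unitize_def sec_def)

lemma sec_diff: "sec r (f - g :: 'a::comm_ring_1 fps) = sec r f - sec r g"
  by (rule fps_ext) simp

lemma sec_fps_X_power:
  assumes "r < 3"
  shows "sec r (fps_X ^ e :: 'a::comm_ring_1 fps) = (if e mod 3 = r then fps_X ^ (e div 3) else 0)"
  by (rule fps_ext) (use assms in \<open>auto, presburger?\<close>)

lemma sec_1:
  assumes "r < 3"
  shows "sec r (1 :: 'a::comm_ring_1 fps) = (if r = 0 then 1 else 0)"
  using sec_fps_X_power[OF assms, of 0] by auto

lemma sec_msum:
  assumes "r < 3"
  shows "sec r (msum I c e) = msum {i\<in>I. e i mod 3 = int r} c (\<lambda>i. e i div 3)"
proof (rule fps_ext)
  fix n
  have "{i\<in>I. e i = int (3 * n + r)} = {i\<in>{i\<in>I. e i mod 3 = int r}. e i div 3 = int n}"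
    using assms by (auto, metis mult_div_mod_eq)
  then show "fps_nth (sec r (msum I c e)) n
      = fps_nth (msum {i\<in>I. e i mod 3 = int r} c (\<lambda>i. e i div 3)) n"
    by (simp only: sec_nth msum_nth)
qed

text \<open>Any series is a formal sum over its coefficient indices, so products of series fall
  under \<open>msum_mult\<close>.\<close>

lemma fps_eq_msum: "f = msum UNIV (fps_nth f) int"
  by (rule fps_ext) (simp add: msum_nth)

lemma admissible_nat: "admissible I int"
proof -
  have "finite {i\<in>I. int i \<le> n}" for n
    by (rule finite_subset[of _ "{..nat n}"]) auto
  then show ?thesis by (simp add: admissible_def)
qed

text \<open>For indices 3 i + s and 3 j + t the exponent is i + j plus the carry of s + t, which
  becomes the power of q in front.\<close>

lemma msum_residues:
  assumes "s < 3" "t < 3"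
  shows "msum {(i, j). i mod 3 = s \<and> j mod 3 = t} (\<lambda>(i, j). fps_nth f i * fps_nth g j)
      (\<lambda>(i, j). (int i + int j) div 3) = fps_X ^ ((s + t) div 3) * (sec s f * sec t g)"
proof -
  have "sec s f * sec t g = msum UNIV (fps_nth (sec s f)) int * msum UNIV (fps_nth (sec t g)) int"
    by (simp only: fps_eq_msum [symmetric])
  also have "\<dots> = msum (UNIV \<times> UNIV) (\<lambda>(i, j). fps_nth f (3 * i + s) * fps_nth g (3 * j + t))
      (\<lambda>(i, j). int i + int j)"
    by (simp add: msum_mult[OF admissible_nat admissible_nat])
  finally have "fps_X ^ ((s + t) div 3) * (sec s f * sec t g)
      = msum UNIV (\<lambda>(i, j). fps_nth f (3 * i + s) * fps_nth g (3 * j + t))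
        (\<lambda>p. (case p of (i, j) \<Rightarrow> int i + int j) + int ((s + t) div 3))"
    by (subst msum_shift) auto
  also have "\<dots> = msum {(i, j). i mod 3 = s \<and> j mod 3 = t} (\<lambda>(i, j). fps_nth f i * fps_nth g j)
      (\<lambda>(i, j). (int i + int j) div 3)"
  proof (rule msum_reindex [symmetric])
    show "bij_betw (\<lambda>(i, j). (3 * i + s, 3 * j + t)) UNIV {(i, j). i mod 3 = s \<and> j mod 3 = t}"
      by (rule bij_betw_byWitness[of _ "\<lambda>(i, j). (i div 3, j div 3)"]) (use assms in auto)
  next
    fix p :: "nat \<times> nat"
    show "(\<lambda>(i, j). (int i + int j) div 3) ((\<lambda>(i, j). (3 * i + s, 3 * j + t)) p)
        = (case p of (i, j) \<Rightarrow> int i + int j) + int ((s + t) div 3)"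
      by (cases p) (simp add: zdiv_int)
  qed auto
  finally show ?thesis by simp
qed

text \<open>Multiplication in the basis 1, q, q^2 over series in q^3; the factors
  \<open>fps_X\<close> are carries.\<close>

lemma sec_mult:
  fixes f g :: "'a::comm_ring_1 fps"
  shows "sec 0 (f * g) = sec 0 f * sec 0 g + fps_X * (sec 1 f * sec 2 g + sec 2 f * sec 1 g)"
    and "sec 1 (f * g) = sec 0 f * sec 1 g + sec 1 f * sec 0 g + fps_X * (sec 2 f * sec 2 g)"
    and "sec 2 (f * g) = sec 0 f * sec 2 g + sec 1 f * sec 1 g + sec 2 f * sec 0 g"
proof -
  let ?c = "\<lambda>(i, j). fps_nth f i * fps_nth g j" and ?e = "\<lambda>(i, j). (int i + int j) div 3"
  have residue: "(int i + int j) mod 3 = int r \<longleftrightarrow> (i mod 3 + j mod 3) mod 3 = r" for i j r :: nat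
  proof -
    have "(int i + int j) mod 3 = int ((i + j) mod 3)" by (simp add: zmod_int)
    then show ?thesis by (simp only: of_nat_eq_iff mod_add_eq)
  qed
  note residues = residue[of _ _ 0, unfolded of_nat_0] residue[of _ _ 1, unfolded of_nat_1]
    residue[of _ _ 2, unfolded of_nat_numeral]
  have mod3: "i mod 3 = 0 \<or> i mod 3 = 1 \<or> i mod 3 = 2" for i :: nat by presburger
  let ?R = "\<lambda>s t. {(i, j). i mod 3 = s \<and> j mod (3::nat) = (t::nat)}"
  have ad: "admissible I ?e" for I
  proof -
    have "finite {p\<in>I. ?e p \<le> n}" for n
    proof (rule finite_subset[of _ "{..nat (3 * n + 3)} \<times> {..nat (3 * n + 3)}"])
      show "{p\<in>I. ?e p \<le> n} \<subseteq> {..nat (3 * n + 3)} \<times> {..nat (3 * n + 3)}"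
        by (auto simp: le_nat_iff)
    qed simp
    then show ?thesis by (auto simp: admissible_def)
  qed
  have fg: "f * g = msum UNIV ?c (\<lambda>(i, j). int i + int j)"
    using msum_mult[OF admissible_nat admissible_nat, of UNIV "fps_nth f" UNIV "fps_nth g"]
    by (simp add: fps_eq_msum [symmetric])
  \<comment> \<open>Each residue of a sum modulo 3 arises from exactly three pairs of
    residues.\<close>
  have *: "sec r (f * g) = fps_X ^ ((s + t) div 3) * (sec s f * sec t g)
       + fps_X ^ ((s' + t') div 3) * (sec s' f * sec t' g)
       + fps_X ^ ((s'' + t'') div 3) * (sec s'' f * sec t'' g)"
    if r: "r < 3" and l: "s < 3" "t < 3" "s' < 3" "t' < 3" "s'' < 3" "t'' < 3"
      and un: "{p. (case p of (i, j) \<Rightarrow> int i + int j) mod 3 = int r} = ?R s t \<union> ?R s' t' \<union> ?R s'' t''"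
      and ne: "(s, t) \<noteq> (s', t')" "(s, t) \<noteq> (s'', t'')" "(s', t') \<noteq> (s'', t'')"
    for r s t s' t' s'' t''
  proof -
    have dj: "?R s t \<inter> ?R s' t' = {}" "(?R s t \<union> ?R s' t') \<inter> ?R s'' t'' = {}"
      using ne by auto
    have "sec r (f * g) = msum (?R s t \<union> ?R s' t' \<union> ?R s'' t'') ?c ?e"
      unfolding fg sec_msum[OF r] un [symmetric] by (rule msum_reindex[of id]) auto
    also have "\<dots> = msum (?R s t) ?c ?e + msum (?R s' t') ?c ?e + msum (?R s'' t'') ?c ?e"
      unfolding msum_Un[OF ad dj(2)] msum_Un[OF ad dj(1)] ..
    finally show ?thesis
      unfolding msum_residues[OF l(1,2)] msum_residues[OF l(3,4)] msum_residues[OF l(5,6)] .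
  qed
  show "sec 0 (f * g) = sec 0 f * sec 0 g + fps_X * (sec 1 f * sec 2 g + sec 2 f * sec 1 g)"
  proof -
    have "{p. (case p of (i, j) \<Rightarrow> int i + int j) mod 3 = int 0} = ?R 0 0 \<union> ?R 1 2 \<union> ?R 2 1" (is "?lhs = ?rhs")
    proof (intro set_eqI)
      fix p :: "nat \<times> nat"
      obtain i j where p: "p = (i, j)" by (cases p)
      show "p \<in> ?lhs \<longleftrightarrow> p \<in> ?rhs"
        using mod3[of i] mod3[of j] by (elim disjE) (simp_all add: p residues del: One_nat_def)
    qed
    from *[OF _ _ _ _ _ _ _ this] show ?thesis by (auto simp: algebra_simps)
  qed
  show "sec 1 (f * g) = sec 0 f * sec 1 g + sec 1 f * sec 0 g + fps_X * (sec 2 f * sec 2 g)"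
  proof -
    have "{p. (case p of (i, j) \<Rightarrow> int i + int j) mod 3 = int 1} = ?R 0 1 \<union> ?R 1 0 \<union> ?R 2 2" (is "?lhs = ?rhs")
    proof (intro set_eqI)
      fix p :: "nat \<times> nat"
      obtain i j where p: "p = (i, j)" by (cases p)
      show "p \<in> ?lhs \<longleftrightarrow> p \<in> ?rhs"
        using mod3[of i] mod3[of j] by (elim disjE) (simp_all add: p residues del: One_nat_def)
    qed
    from *[OF _ _ _ _ _ _ _ this] show ?thesis by (auto simp: algebra_simps)
  qed
  show "sec 2 (f * g) = sec 0 f * sec 2 g + sec 1 f * sec 1 g + sec 2 f * sec 0 g"
  proof -
    have "{p. (case p of (i, j) \<Rightarrow> int i + int j) mod 3 = int 2} = ?R 0 2 \<union> ?R 1 1 \<union> ?R 2 0" (is "?lhs = ?rhs")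
    proof (intro set_eqI)
      fix p :: "nat \<times> nat"
      obtain i j where p: "p = (i, j)" by (cases p)
      show "p \<in> ?lhs \<longleftrightarrow> p \<in> ?rhs"
        using mod3[of i] mod3[of j] by (elim disjE) (simp_all add: p residues del: One_nat_def)
    qed
    from *[OF _ _ _ _ _ _ _ this] show ?thesis by (auto simp: algebra_simps)
  qed
qed

section \<open>The cubic norm and Euler products\<close>

text \<open>
  The norm of \<open>f\<close> over series in \<open>q\<^sup>3\<close>, i.e. the product of \<open>f(\<omega>\<^sup>j q)\<close> over the cube roots of unity
  \<open>\<omega>\<^sup>j\<close>, with \<open>q\<^sup>3\<close> renamed to \<open>q\<close>. Written through the sections, it needs no \<open>\<omega>\<close> in the
  coefficient ring.
\<close>

definition sec_norm :: "'a::comm_ring_1 fps \<Rightarrow> 'a fps"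
  where "sec_norm f = sec 0 f ^ 3 + fps_X * sec 1 f ^ 3 + fps_X ^ 2 * sec 2 f ^ 3
    - 3 * fps_X * sec 0 f * sec 1 f * sec 2 f"

text \<open>The form is the norm of x + y s + z s^2 with s^3 = q; its multiplicativity is a
  polynomial identity.\<close>

lemma cubic_norm_mult:
  fixes q :: "'a::comm_ring_1"
  defines "N \<equiv> \<lambda>x y z. x ^ 3 + q * y ^ 3 + q ^ 2 * z ^ 3 - 3 * q * x * y * z"
  shows "N (a * d + q * (b * f + c * e)) (a * e + b * d + q * (c * f)) (a * f + b * e + c * d)
    = N a b c * N d e f"
proof -
  have three: "3 * w = w + w + w" for w :: 'a
  proof -
    have "3 * w = (1 + 1 + 1) * w" by simp
    then show ?thesis by (simp only: distrib_right mult_1_left)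
  qed
  show ?thesis
    unfolding N_def mult.assoc three
    by (simp add: power3_eq_cube power2_eq_square algebra_simps)
qed

lemma sec_norm_mult: "sec_norm (f * g) = sec_norm f * sec_norm g"
  unfolding sec_norm_def sec_mult by (rule cubic_norm_mult)

lemma sec_norm_1 [simp]: "sec_norm 1 = 1"
  by (simp add: sec_norm_def sec_1)

lemma sec_norm_power: "sec_norm (f ^ n) = sec_norm f ^ n"
  by (induction n) (simp_all add: sec_norm_mult)

text \<open>Coefficient n of a section is coefficient 3 n + r of the series, hence the threefold
  precision.\<close>

lemma eqmod_sec: "eqmod (3 * M) f g \<Longrightarrow> r < 3 \<Longrightarrow> eqmod M (sec r f) (sec r g)"
  by (simp add: eqmod_def)

lemma eqmod_sec_norm: "eqmod (3 * M) f g \<Longrightarrow> eqmod M (sec_norm f) (sec_norm g)"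
  unfolding sec_norm_def
  by (intro eqmod_add eqmod_diff eqmod_mult eqmod_power eqmod_refl eqmod_sec) simp_all

text \<open>If 3 divides e, the conjugates 1 - (\<omega>^j q)^e coincide; otherwise their product is
  1 - q^(3 e). Then q^3 is renamed to q.\<close>

lemma sec_norm_binomial:
  "sec_norm (1 - fps_X ^ e) = (if 3 dvd e then (1 - fps_X ^ (e div 3)) ^ 3 else 1 - fps_X ^ e)"
proof -
  have s: "sec r (1 - fps_X ^ e :: 'a fps)
      = (if r = 0 then 1 else 0) - (if e mod 3 = r then fps_X ^ (e div 3) else 0)" if "r < 3" for r
    using that by (simp add: sec_diff sec_1 sec_fps_X_power)
  have c: "(- x) ^ 3 = - (x ^ 3)" for x :: "'a fps" by (simp add: power3_eq_cube)
  have "e mod 3 = 0 \<or> e mod 3 = 1 \<or> e mod 3 = 2" by presburger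
  then show ?thesis
  proof (elim disjE)
    assume e: "e mod 3 = 1"
    then have "e = 1 + e div 3 * 3" by presburger
    then have "(fps_X ^ e :: 'a fps) = fps_X * (fps_X ^ (e div 3)) ^ 3"
      by (metis power_add power_mult power_one_right)
    moreover have "sec_norm (1 - fps_X ^ e :: 'a fps) = 1 - fps_X * (fps_X ^ (e div 3)) ^ 3"
      using e by (simp add: sec_norm_def s c)
    moreover have "\<not> 3 dvd e" using e by (simp add: dvd_eq_mod_eq_0)
    ultimately show ?thesis by (simp only: if_False)
  next
    assume e: "e mod 3 = 2"
    then have "e = 2 + e div 3 * 3" by presburger
    then have "(fps_X ^ e :: 'a fps) = fps_X ^ 2 * (fps_X ^ (e div 3)) ^ 3"
      by (metis power_add power_mult)
    moreover have "sec_norm (1 - fps_X ^ e :: 'a fps) = 1 - fps_X ^ 2 * (fps_X ^ (e div 3)) ^ 3"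
      using e by (simp add: sec_norm_def s c)
    moreover have "\<not> 3 dvd e" using e by (simp add: dvd_eq_mod_eq_0)
    ultimately show ?thesis by (simp only: if_False)
  qed (simp add: sec_norm_def s dvd_eq_mod_eq_0)
qed

lemma qpoch_euler: "qpoch (fps_X ^ m) m n = (\<Prod>k<n. 1 - fps_X ^ (m * Suc k))"
  by (simp add: qpoch_def power_add)

lemma eqmod_euler_f: "m > 0 \<Longrightarrow> n \<ge> M \<Longrightarrow> eqmod M (euler_f m) (qpoch (fps_X ^ m) m n)"
  unfolding euler_f_def by (rule eqmod_sym, rule eqmod_qpoch_inf) auto

lemma euler_f_nth_0: "m > 0 \<Longrightarrow> fps_nth (euler_f m) 0 = 1"
  unfolding euler_f_def by (rule qpoch_inf_has_prod) auto

text \<open>The norm fixes factors whose exponent is not divisible by 3 and turns 1 - q^(6 j) into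
  (1 - q^(2 j))^3; the factors 1 - q^(6 j) supplied on the left complete the first product on the
  right.\<close>

lemma sec_norm_qpoch:
  "sec_norm (qpoch (fps_X ^ 2) 2 (3 * n)) * qpoch (fps_X ^ 6) 6 n
    = qpoch (fps_X ^ 2) 2 (3 * n) * qpoch (fps_X ^ 2) 2 n ^ 3"
proof (induction n)
  case (Suc n)
  let ?P = "qpoch (fps_X ^ 2) 2 :: nat \<Rightarrow> 'a fps"
  let ?a = "1 - fps_X ^ (6 * n + 2) :: 'a fps" and ?b = "1 - fps_X ^ (6 * n + 4) :: 'a fps"
    and ?c = "1 - fps_X ^ (6 * n + 6) :: 'a fps" and ?d = "1 - fps_X ^ (2 * n + 2) :: 'a fps"
  have 1: "?P (3 * Suc n) = ?P (3 * n) * ?a * ?b * ?c"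
  proof -
    have "3 * Suc n = Suc (Suc (Suc (3 * n)))" by simp
    moreover have "2 * Suc (3 * n) = 6 * n + 2" "2 * Suc (Suc (3 * n)) = 6 * n + 4"
      "2 * Suc (Suc (Suc (3 * n))) = 6 * n + 6" by simp_all
    ultimately show ?thesis by (simp only: qpoch_euler prod.lessThan_Suc)
  qed
  have 2: "?P (Suc n) = ?P n * ?d"
    by (simp add: qpoch_euler algebra_simps)
  have 3: "qpoch (fps_X ^ 6) 6 (Suc n) = qpoch (fps_X ^ 6) 6 n * ?c"
    by (simp add: qpoch_euler algebra_simps)
  have "\<not> 3 dvd 6 * n + 2" "\<not> 3 dvd 6 * n + 4" "3 dvd 6 * n + 6" "(6 * n + 6) div 3 = 2 * n + 2"
    by presburger+
  then have "sec_norm ?a = ?a" "sec_norm ?b = ?b" "sec_norm ?c = ?d ^ 3"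
    by (simp_all only: sec_norm_binomial if_True if_False)
  then have "sec_norm (?P (3 * Suc n)) * qpoch (fps_X ^ 6) 6 (Suc n)
      = (sec_norm (?P (3 * n)) * qpoch (fps_X ^ 6) 6 n) * (?a * ?b * ?c * ?d ^ 3)"
    unfolding 1 3 sec_norm_mult by (simp only: mult_ac)
  also have "\<dots> = ?P (3 * Suc n) * ?P (Suc n) ^ 3"
    unfolding Suc.IH 1 2 power_mult_distrib by (simp only: mult_ac)
  finally show ?case .
qed simp

lemma sec_norm_euler_f_2: "sec_norm (euler_f 2) * euler_f 6 = (euler_f 2 :: 'a::comm_ring_1 fps) ^ 4"
proof (rule eqmod_imp_eq)
  fix M
  have "eqmod M (sec_norm (euler_f 2) * euler_f 6 :: 'a fps)
      (sec_norm (qpoch (fps_X ^ 2) 2 (3 * M)) * qpoch (fps_X ^ 6) 6 M)"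
    by (intro eqmod_mult eqmod_sec_norm eqmod_euler_f) simp_all
  also have "\<dots> = qpoch (fps_X ^ 2) 2 (3 * M) * qpoch (fps_X ^ 2) 2 M ^ 3"
    by (rule sec_norm_qpoch)
  also have "eqmod M \<dots> (euler_f 2 * euler_f 2 ^ 3)"
    by (intro eqmod_mult eqmod_power eqmod_sym[OF eqmod_euler_f]) simp_all
  finally show "eqmod M (sec_norm (euler_f 2) * euler_f 6) ((euler_f 2 :: 'a fps) ^ 4)"
    by (simp add: power_eq_if)
qed

section \<open>Pentagonal series and the cube of \<open>euler_f 2\<close>\<close>

theorem pentagonal_number_theorem:
  assumes m: "m > 0"
  shows "theta (- 1) (- 1) (3 * int m) (int m) = (euler_f (2 * m) :: 'a::comm_ring_1 fps)"
proof -
  \<comment> \<open>Exponents congruent to 0, 4 m and 2 m modulo 6 m together exhaust the multiples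
    of 2 m.\<close>
  have fin: "qpoch (fps_X ^ (6 * m)) (6 * m) n * (qpoch (fps_X ^ (4 * m)) (6 * m) n
      * qpoch (fps_X ^ (2 * m)) (6 * m) n) = (qpoch (fps_X ^ (2 * m)) (2 * m) (3 * n) :: 'a fps)" for n
  proof (induction n)
    case (Suc n)
    have 1: "(qpoch (fps_X ^ (2 * m)) (2 * m) (3 * Suc n) :: 'a fps)
      = qpoch (fps_X ^ (2 * m)) (2 * m) (3 * n) * (1 - fps_X ^ (2 * m) * fps_X ^ (6 * m * n))
        * (1 - fps_X ^ (4 * m) * fps_X ^ (6 * m * n)) * (1 - fps_X ^ (6 * m) * fps_X ^ (6 * m * n))"
    proof -
      have "3 * Suc n = Suc (Suc (Suc (3 * n)))" by simp
      moreover have "2 * m + 2 * m * (3 * n) = 2 * m + 6 * m * n"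
        "2 * m + 2 * m * Suc (3 * n) = 4 * m + 6 * m * n"
        "2 * m + 2 * m * Suc (Suc (3 * n)) = 6 * m + 6 * m * n" by simp_all
      ultimately show ?thesis by (simp only: qpoch_Suc power_add [symmetric])
    qed
    show ?case
      unfolding 1 Suc.IH [symmetric] unfolding qpoch_Suc by (simp only: mult_ac)
  qed simp
  have "theta (- 1) (- 1) (3 * int m) (int m) = qpoch_inf (fps_X ^ (6 * m)) (6 * m)
      * (qpoch_inf (fps_X ^ (4 * m)) (6 * m) * (qpoch_inf (fps_X ^ (2 * m)) (6 * m) :: 'a fps))"
  proof -
    have e: "nat (2 * (3 * int m)) = 6 * m" "nat (3 * int m + int m) = 4 * m"
      "nat (3 * int m - int m) = 2 * m" by simp_all
    have c: "- (fps_const (- 1) * f) = f" for f :: "'a fps"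
      by (simp flip: fps_const_neg)
    show ?thesis
      using Jacobi_triple_product[of "- 1 :: 'a" "- 1" "int m" "3 * int m"] m
      unfolding e c by simp
  qed
  also have "\<dots> = euler_f (2 * m)"
  proof (rule eqmod_imp_eq)
    fix M
    have "eqmod M (qpoch_inf (fps_X ^ (6 * m)) (6 * m)
      * (qpoch_inf (fps_X ^ (4 * m)) (6 * m) * (qpoch_inf (fps_X ^ (2 * m)) (6 * m) :: 'a fps)))
      (qpoch (fps_X ^ (6 * m)) (6 * m) M * (qpoch (fps_X ^ (4 * m)) (6 * m) M
        * qpoch (fps_X ^ (2 * m)) (6 * m) M))"
      by (intro eqmod_mult eqmod_sym[OF eqmod_qpoch_inf]) (use m in simp_all)
    also have "\<dots> = qpoch (fps_X ^ (2 * m)) (2 * m) (3 * M)" by (rule fin)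
    also have "eqmod M \<dots> (euler_f (2 * m))"
      by (rule eqmod_sym, rule eqmod_euler_f) (use m in simp_all)
    finally show "eqmod M (qpoch_inf (fps_X ^ (6 * m)) (6 * m)
      * (qpoch_inf (fps_X ^ (4 * m)) (6 * m) * (qpoch_inf (fps_X ^ (2 * m)) (6 * m) :: 'a fps)))
      (euler_f (2 * m))" .
  qed
  finally show ?thesis .
qed

lemmas pentagonal_2 = pentagonal_number_theorem[of 1, simplified]
lemmas pentagonal_6 = pentagonal_number_theorem[of 3, simplified]

lemma zpow_minus_1_mult_3: "zpow (- 1) (- 1) (3 * k) = (zpow (- 1) (- 1) k :: 'a::comm_ring_1)"
  and zpow_minus_1_uminus: "zpow (- 1) (- 1) (- k) = (zpow (- 1) (- 1) k :: 'a::comm_ring_1)"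
proof -
  let ?z = "zpow (- 1) (- 1) :: int \<Rightarrow> 'a"
  show u: "?z (- k) = ?z k" for k
    by (auto simp: zpow_def)
  have "?z (3 * k) = ?z (k + k + k)" by simp
  also have "\<dots> = ?z k * ?z k * ?z k"
    by (simp only: zpow_add[of "- 1" "- 1 :: 'a", simplified])
  also have "?z k * ?z k = ?z k * ?z (- k)" by (simp only: u)
  also have "\<dots> = 1"
    by (simp flip: zpow_add[of "- 1" "- 1 :: 'a", simplified])
  finally show "?z (3 * k) = ?z k" by simp
qed

text \<open>With n = 3 k the exponent is 9 k^2 + 3 k and the sign (-1)^k: the pentagonal series for
  \<open>euler_f 6\<close>.\<close>

lemma theta0_3_1: "theta0 (- 1) (- 1) 3 1 = (euler_f 6 :: 'a::comm_ring_1 fps)"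
proof -
  have "theta0 (- 1) (- 1) 3 1 = theta (- 1 :: 'a) (- 1) 9 3"
    unfolding theta0_def theta_def
  proof (rule msum_reindex)
    show "bij_betw (\<lambda>k. 3 * k) UNIV {n :: int. 3 dvd n}"
      by (rule bij_betw_byWitness[of _ "\<lambda>n. n div 3"]) auto
  qed (simp_all add: zpow_minus_1_mult_3 third_of_square)
  then show ?thesis by (simp add: pentagonal_6)
qed

text \<open>Terms with n = 3 k + 1 cancel in pairs under n -> -(n + 1), which keeps the exponent and
  flips the sign. Those with n = -(3 k + 1) give the negated pentagonal series, shifted by
  2.\<close>

lemma theta1_3_1: "theta1 (- 1) (- 1) 3 1 = - (fps_X ^ 2 * (euler_f 6 :: 'a::comm_ring_1 fps))"
proof -
  define e where "e = (\<lambda>n::int. 3 * ((n\<^sup>2 + 2) div 3) + 1 * n)"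
  let ?z = "zpow (- 1) (- 1) :: int \<Rightarrow> 'a"
  let ?A = "{n::int. n mod 3 = 1 \<and> 0 \<le> n}" and ?B = "{n::int. n mod 3 = 1 \<and> n < 0}"
    and ?C = "{n::int. n mod 3 = 2}"
  have ad: "admissible I e" for I
    unfolding e_def by (rule admissible_theta01) simp
  have z1: "?z (i + 1) = - ?z i" for i
    using zpow_add_1[of "- 1 :: 'a" "- 1" i] by simp
  have "{n::int. \<not> 3 dvd n} = (?A \<union> ?B) \<union> ?C" by (auto; presburger)
  then have "theta1 (- 1) (- 1) 3 1 = msum ((?A \<union> ?B) \<union> ?C) ?z e"
    by (simp add: theta1_def e_def)
  also have "\<dots> = msum ?A ?z e + msum ?B ?z e + msum ?C ?z e"
    by (subst msum_Un[OF ad], force, subst msum_Un[OF ad]) auto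
  also have "msum ?B ?z e = msum ?A (\<lambda>n. - ?z n) e"
  proof (rule msum_reindex)
    show "bij_betw (\<lambda>n. - (n + 1)) ?A ?B"
      by (rule bij_betw_byWitness[of _ "\<lambda>n. - (n + 1)"]) (auto; presburger)+
  next
    fix n assume "n \<in> ?A"
    then have "n = 3 * (n div 3) + 1" by simp presburger
    then obtain k where n: "n = 3 * k + 1" by blast
    have n': "- (n + 1) = 3 * (- k - 1) + 1" by (simp add: n)
    show "e (- (n + 1)) = e n"
      unfolding n' unfolding n e_def third_of_square by (simp add: power2_eq_square algebra_simps)
    show "?z (- (n + 1)) = - ?z n"
      by (simp only: zpow_minus_1_uminus z1)
  qed
  also have "msum ?C ?z e = msum UNIV (\<lambda>k. - ?z k) (\<lambda>k. (9 * k\<^sup>2 + 3 * k) + int 2)"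
  proof (rule msum_reindex)
    show "bij_betw (\<lambda>k. - (3 * k + 1)) UNIV ?C"
      by (rule bij_betw_byWitness[of _ "\<lambda>n. - ((n + 1) div 3)"]) (auto; presburger)+
  next
    fix k :: int
    have k': "- (3 * k + 1) = 3 * (- k) - 1" by simp
    show "e (- (3 * k + 1)) = (9 * k\<^sup>2 + 3 * k) + int 2"
      unfolding k' e_def third_of_square by simp
    show "?z (- (3 * k + 1)) = - ?z k"
      by (simp only: zpow_minus_1_uminus z1 zpow_minus_1_mult_3)
  qed
  also have "\<dots> = fps_X ^ 2 * msum UNIV (\<lambda>k. - ?z k) (\<lambda>k. 9 * k\<^sup>2 + 3 * k)"
    using admissible_theta[of 3 9 UNIV] by (intro msum_shift) (auto simp: admissible_def)
  also have "\<dots> = - (fps_X ^ 2 * theta (- 1) (- 1) 9 3)"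
    by (simp add: msum_uminus theta_def)
  finally show ?thesis
    by (simp add: msum_uminus pentagonal_6)
qed

text \<open>This is \<open>theta_cubed\<close> at x = y = -1, u = 3, v = 1, where all theta series
  involved are expressed by Euler products.\<close>

lemma euler_f_2_cubed:
  "(euler_f 2 :: 'a::comm_ring_1 fps) ^ 3 = euler_f 6 * (cubic_a 3 - fps_X ^ 2 * cubic_c 3)"
proof -
  have "(euler_f 2 :: 'a fps) ^ 3 = theta (- 1) (- 1) 3 1 ^ 3"
    by (simp add: pentagonal_2)
  also have "\<dots> = cubic_a 3 * euler_f 6 + cubic_c 3 * - (fps_X ^ 2 * euler_f 6)"
    by (subst theta_cubed) (simp_all add: theta0_3_1 theta1_3_1)
  finally show ?thesis by (simp add: algebra_simps)
qed

lemma sec_msum_mult_3: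
  assumes "r < 3"
  shows "sec r (msum I c (\<lambda>i. 3 * e i)) = (if r = 0 then msum I c e else 0)"
proof (cases "r = 0")
  case True
  then show ?thesis by (simp add: sec_msum)
next
  case False
  then have "{i\<in>I. 3 * e i mod 3 = int r} = {}" by auto
  then show ?thesis
    unfolding sec_msum[OF assms] using False by (simp add: msum_def fps_zero_def)
qed

lemma sec_cubic_a:
  assumes "r < 3"
  shows "sec r (cubic_a 3) = (if r = 0 then cubic_a 1 else 0)"
  using sec_msum_mult_3[OF assms, of UNIV "\<lambda>_. 1" "\<lambda>(i, j). i\<^sup>2 + j\<^sup>2 + (i + j)\<^sup>2"]
  by (simp only: cubic_a_def case_prod_unfold mult_1_left)

lemma sec_cubic_c:
  assumes "r < 3"
  shows "sec r (cubic_c 3) = (if r = 0 then cubic_c 1 else 0)"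
  using sec_msum_mult_3[OF assms, of UNIV "\<lambda>_. 1" "\<lambda>(i, j). i\<^sup>2 + j\<^sup>2 + (1 - i - j)\<^sup>2 - 1"]
  by (simp only: cubic_c_def case_prod_unfold mult_1_left)

lemma sec_euler_f_6:
  assumes "r < 3"
  shows "sec r (euler_f 6) = (if r = 0 then euler_f 2 else 0)"
  using sec_msum_mult_3[OF assms, of UNIV "zpow (- 1) (- 1)" "\<lambda>n. 3 * n\<^sup>2 + n"]
  by (cases "r = 0") (simp_all add: theta_def flip: pentagonal_6 pentagonal_2)

lemma sec_cubic_diff:
  fixes W :: "'a::comm_ring_1 fps"
  defines "W \<equiv> cubic_a 3 - fps_X ^ 2 * cubic_c 3"
  shows "sec 0 W = cubic_a 1" "sec 1 W = 0" "sec 2 W = - cubic_c 1"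
  by (simp_all add: W_def sec_diff sec_mult sec_cubic_a sec_cubic_c sec_fps_X_power del: One_nat_def)

text \<open>Apply \<open>sec_norm\<close> to both sides of \<open>euler_f_2_cubed\<close>:
  \<open>euler_f 6\<close> has norm \<open>euler_f 2 ^ 3\<close>, the other factor has norm a^3 -
  q^2 c^3, and \<open>sec_norm_euler_f_2\<close> evaluates the left side.\<close>

lemma euler_f_6_cubic_diff:
  "(euler_f 6 :: 'a::comm_ring_1 fps) ^ 3 * (cubic_a 1 ^ 3 - fps_X ^ 2 * cubic_c 1 ^ 3) = euler_f 2 ^ 9"
proof -
  let ?f2 = "euler_f 2 :: 'a fps" and ?f6 = "euler_f 6 :: 'a fps"
  let ?D = "cubic_a 1 ^ 3 - fps_X ^ 2 * cubic_c 1 ^ 3 :: 'a fps"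
  have N6: "sec_norm ?f6 = ?f2 ^ 3"
    by (simp add: sec_norm_def sec_euler_f_6 del: One_nat_def)
  have "sec_norm ?f2 ^ 3 = sec_norm (?f6 * (cubic_a 3 - fps_X ^ 2 * cubic_c 3))"
    by (simp only: sec_norm_power [symmetric] euler_f_2_cubed)
  also have "\<dots> = ?f2 ^ 3 * ?D"
    unfolding sec_norm_mult N6
    by (simp add: sec_norm_def sec_cubic_diff power3_eq_cube del: One_nat_def)
  finally have "?f2 ^ 3 * (?f6 ^ 3 * ?D) = (sec_norm ?f2 * ?f6) ^ 3"
    by (simp only: power_mult_distrib mult_ac)
  also have "\<dots> = ?f2 ^ 3 * ?f2 ^ 9"
    unfolding sec_norm_euler_f_2 by (simp flip: power_mult power_add)
  finally show ?thesis
    by (rule fps_cancel_unit[rotated]) (simp add: euler_f_nth_0 fps_nth_power_0)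
qed

section \<open>Dissection of theta and the final elimination\<close>

lemma sec_theta:
  shows "sec 0 (theta x y 1 0) = theta0 x y 1 0"
    and "fps_X * sec 1 (theta x y 1 0) = theta1 x y 1 0"
    and "sec 2 (theta x y 1 0) = 0"
proof -
  \<comment> \<open>Squares are 0 or 1 modulo 3; \<open>(n\<^sup>2 + 2) div 3\<close> exceeds
    \<open>n\<^sup>2 div 3\<close> by 1 exactly in the second case, which accounts for the factor
    \<open>fps_X\<close>.\<close>
  have sq: "n\<^sup>2 mod 3 = (if 3 dvd n then 0 else 1)"
    "(n\<^sup>2 + 2) div 3 = n\<^sup>2 div 3 + (if 3 dvd n then 0 else 1)" for n :: int
  proof -
    show *: "n\<^sup>2 mod 3 = (if 3 dvd n then 0 else 1)"
    proof (cases n rule: int_mod_3_cases)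
      case (1 k)
      then show ?thesis by (simp add: power2_eq_square)
    next
      case (2 k)
      have e: "n\<^sup>2 = 3 * (3 * k\<^sup>2 + 2 * k) + 1"
        unfolding 2 by (simp add: power2_eq_square algebra_simps)
      have "\<not> 3 dvd n" unfolding 2 by presburger
      then show ?thesis unfolding e mod_mult_self4 by simp
    next
      case (3 k)
      have e: "n\<^sup>2 = 3 * (3 * k\<^sup>2 - 2 * k) + 1"
        unfolding 3 by (simp add: power2_eq_square algebra_simps)
      have "\<not> 3 dvd n" unfolding 3 by presburger
      then show ?thesis unfolding e mod_mult_self4 by simp
    qed
    show "(n\<^sup>2 + 2) div 3 = n\<^sup>2 div 3 + (if 3 dvd n then 0 else 1)"
    proof (cases "3 dvd n")
      case True
      with * have "n\<^sup>2 mod 3 = 0" by simp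
      then show ?thesis using True by simp presburger
    next
      case False
      with * have "n\<^sup>2 mod 3 = 1" by simp
      then show ?thesis using False by simp presburger
    qed
  qed
  show "sec 0 (theta x y 1 0) = theta0 x y 1 0"
    unfolding theta_def theta0_def
    by (subst sec_msum, simp, rule msum_reindex[of id]) (auto simp: sq split: if_splits)
  have "fps_X * sec 1 (theta x y 1 0)
      = fps_X ^ 1 * msum {n. \<not> 3 dvd n} (zpow x y) (\<lambda>n. n\<^sup>2 div 3)"
    unfolding theta_def power_one_right
    by (intro arg_cong[where f = "(*) fps_X"], subst sec_msum, simp, rule msum_reindex[of id])
       (auto simp: sq split: if_splits)
  also have "\<dots> = msum {n. \<not> 3 dvd n} (zpow x y) (\<lambda>n. n\<^sup>2 div 3 + int 1)"
    by (rule msum_shift [symmetric]) (simp add: pos_imp_zdiv_nonneg_iff)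
  also have "\<dots> = theta1 x y 1 0"
    unfolding theta1_def by (rule msum_reindex[of id]) (auto simp: sq)
  finally show "fps_X * sec 1 (theta x y 1 0) = theta1 x y 1 0" .
  have "{n \<in> UNIV. (1 * n\<^sup>2 + 0 * n) mod 3 = int 2} = {}"
    by (auto simp: sq)
  then show "sec 2 (theta x y 1 0) = 0"
    unfolding theta_def by (subst sec_msum) (simp_all add: msum_def fps_zero_def)
qed

lemma theta_eq_qpoch_inf:
  fixes X X' :: "'a::comm_ring_1"
  assumes "X * X' = 1"
  shows "theta (- X) (- X') 1 0
    = euler_f 2 * (qpoch_inf (fps_X * fps_const X) 2 * qpoch_inf (fps_X * fps_const X') 2)"
proof -
  have c: "- (fps_const (- X) * fps_X ^ nat 1) = fps_X * fps_const X" for X :: 'a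
    by (simp add: mult.commute flip: fps_const_neg)
  show ?thesis
    using Jacobi_triple_product[of "- X" "- X'" 0 1] assms
    by (simp add: euler_f_def c[simplified])
qed

text \<open>\<open>X'\<close> and \<open>Y'\<close> are inverses of \<open>X\<close> and
  \<open>Y\<close> in an arbitrary commutative ring; Laurent polynomials over the integers give the
  formal statement.\<close>

theorem theorem1p4:
  fixes X X' Y Y' :: "'a::comm_ring_1"
  assumes "X * X' = 1" and "Y * Y' = 1"
  defines "F \<equiv> fps_quot1 (euler_f 6) (euler_f 2) *
    qpoch_inf_list
      [fps_X * fps_const X, fps_X * fps_const X', fps_X * fps_const Y, fps_X * fps_const Y'] 2"
  shows "unitize 3 F = F ^ 3"
proof -
  let ?f2 = "euler_f 2 :: 'a fps" and ?f6 = "euler_f 6 :: 'a fps"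
  let ?a = "cubic_a 1 :: 'a fps" and ?c = "cubic_c 1 :: 'a fps"
  define W where "W = (cubic_a 3 - fps_X ^ 2 * cubic_c 3 :: 'a fps)"
  define A where "A = theta (- X) (- X') 1 0"
  define B where "B = theta (- Y) (- Y') 1 0"
  have quot: "fps_quot1 ?f6 ?f2 * ?f2 = ?f6"
    by (rule fps_quot1_euler_f) simp
  \<comment> \<open>\<open>A\<close> and \<open>B\<close> each absorb one \<open>euler_f 2\<close>;
    the third clears the quotient.\<close>
  have "F * ?f2 ^ 3 = (fps_quot1 ?f6 ?f2 * ?f2) * (A * B)"
    by (simp add: F_def A_def B_def theta_eq_qpoch_inf assms qpoch_inf_list_def power3_eq_cube mult_ac)
  then have F2: "F * ?f2 ^ 3 = ?f6 * (A * B)"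
    by (simp only: quot)
  then have "?f6 * (F * W) = ?f6 * (A * B)"
    by (simp only: euler_f_2_cubed W_def mult_ac)
  then have FW: "F * W = A * B"
    by (rule fps_cancel_unit[rotated]) (simp add: euler_f_nth_0)
  let ?F0 = "sec 0 F" and ?F1 = "sec 1 F" and ?F2 = "sec 2 F"
  let ?A0 = "sec 0 A" and ?A1 = "sec 1 A" and ?B0 = "sec 0 B" and ?B1 = "sec 1 B"
  have A2: "sec 2 A = 0" and B2: "sec 2 B = 0"
    by (simp_all add: A_def B_def sec_theta)
  note W = sec_cubic_diff[where ?'a = 'a, folded W_def]
  \<comment> \<open>The sections of \<open>F * W = A * B\<close> give three linear relations among
    the sections of \<open>F\<close>.\<close>
  have s0: "?A0 * ?B0 = ?F0 * ?a - fps_X * ?F1 * ?c"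
    using arg_cong[OF FW, of "sec 0"] unfolding sec_mult W A2 B2 by (simp add: algebra_simps)
  have s1: "?A0 * ?B1 + ?A1 * ?B0 = ?F1 * ?a - fps_X * ?F2 * ?c"
    using arg_cong[OF FW, of "sec 1"] unfolding sec_mult W A2 B2 by (simp add: algebra_simps)
  have s2: "?A1 * ?B1 = ?F2 * ?a - ?F0 * ?c"
    using arg_cong[OF FW, of "sec 2"] unfolding sec_mult W A2 B2 by (simp add: algebra_simps)
  have A3: "A ^ 3 = ?a * ?A0 + ?c * (fps_X * ?A1)" and B3: "B ^ 3 = ?a * ?B0 + ?c * (fps_X * ?B1)"
    using assms by (simp_all add: A_def B_def theta_cubed sec_theta del: One_nat_def)
  \<comment> \<open>The product of the two cubes is the combination of the three relations in which
    sections 1 and 2 of \<open>F\<close> cancel.\<close>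
  have "A ^ 3 * B ^ 3 = ?a ^ 2 * (?A0 * ?B0) + fps_X * ?a * ?c * (?A0 * ?B1 + ?A1 * ?B0)
      + fps_X ^ 2 * ?c ^ 2 * (?A1 * ?B1)"
    unfolding A3 B3 by (simp add: algebra_simps power2_eq_square)
  also have "\<dots> = ?F0 * (?a ^ 3 - fps_X ^ 2 * ?c ^ 3)"
    unfolding s0 s1 s2 by (simp add: algebra_simps power2_eq_square power3_eq_cube)
  finally have AB: "A ^ 3 * B ^ 3 = ?F0 * (?a ^ 3 - fps_X ^ 2 * ?c ^ 3)" .
  have "?f2 ^ 9 * F ^ 3 = (F * ?f2 ^ 3) ^ 3"
    by (simp add: power_mult_distrib mult_ac flip: power_mult)
  also have "\<dots> = ?f6 ^ 3 * (A ^ 3 * B ^ 3)"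
    unfolding F2 by (simp only: power_mult_distrib)
  also have "\<dots> = ?f2 ^ 9 * ?F0"
    unfolding AB euler_f_6_cubic_diff [symmetric] by (simp only: mult_ac)
  finally have "F ^ 3 = ?F0"
    by (rule fps_cancel_unit[rotated]) (simp add: euler_f_nth_0 fps_nth_power_0)
  then show ?thesis by (simp add: unitize_3)
qed

end
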